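(* Let $A\in\mathbb{R}^{m\times n}$ with $n>m$, let $\epsilon>0$ and let $k\geq 1$ be an integer. Let $\alpha_k$ be the value of the maximization problem defined in the context, let $SDP_k$ be the optimal value of the semidefinite program defined in the context, and let $(X,Y,Z)$ be an optimal solution of this semidefinite program. Set $$\delta=3+\frac{3\left(\|Z\|_F^2+\mathrm{Tr}(XY)\right)}{\epsilon^2},$$ $$g(X,\delta)=\left(\sqrt{2/\pi}+\sqrt{2\log\delta}\right)\sum_{i=1}^n (X_{ii})^{1/2},$$ $$h(Y,n,k,\delta)=\max\left\{\left(\sqrt{2\log 2n}+\sqrt{2\log\delta}\right)\max_{i=1,\ldots,n}(Y_{ii})^{1/2},\ \frac{\left(\sqrt{2/\pi}+\sqrt{2\log\delta}\right)\sum_{i=1}^n (Y_{ii})^{1/2}}{k}\right\}.$$ Then $$\frac{SDP_k-\epsilon}{g(X,\delta)\,h(Y,n,k,\delta)}\ \leq\ \alpha_k\ \leq\ SDP_k .$$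
   Context: For $A\in\mathbb{R}^{m\times n}$ with $n>m$ and an integer $k\ge 1$, define $$\alpha_k=\max_{\{x\in\mathbb{R}^n:\ Ax=0,\ \|x\|_1=1\}}\ \ \max_{\{y\in\mathbb{R}^n:\ \|y\|_\infty=1,\ \|y\|_1\leq k\}} y^Tx .$$ The semidefinite program, with optimal value denoted $SDP_k$, is $$\begin{array}{ll} \mbox{maximize} & \mathrm{Tr}(Z)\\ \mbox{subject to} & AXA^T=0,\ \|X\|_1\leq 1,\\ & \|Y\|_\infty\leq 1,\ \|Y\|_1\leq k^2,\ \|Z\|_1\leq k,\\ & \left(\begin{array}{cc} X & Z^T\\ Z & Y\end{array}\right)\succeq 0, \end{array}$$ in the variables $X,Y$ (symmetric $n\times n$ real matrices) and $Z\in\mathbb{R}^{n\times n}$. For a matrix $M$, $\|M\|_1$ denotes the sum of the absolute values of its entries, $\|M\|_\infty$ the largest absolute value of its entries, and $\|M\|_F$ the Frobenius norm. $\succeq 0$ means positive semidefinite, and $\log$ is the natural logarithm. *)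

theory Defs
  imports "HOL-Analysis.Analysis"
begin

definition vec_norm1 :: "real^'n \<Rightarrow> real" where
  "vec_norm1 x = (\<Sum>i\<in>UNIV. \<bar>x $ i\<bar>)"

text \<open>The matrix norms below are entrywise, not operator norms.\<close>

definition mat_norm1 :: "real^'n^'m \<Rightarrow> real" where
  "mat_norm1 M = (\<Sum>i\<in>UNIV. \<Sum>j\<in>UNIV. \<bar>M $ i $ j\<bar>)"

definition mat_norm_inf :: "real^'n^'m \<Rightarrow> real" where
  "mat_norm_inf M = Max {\<bar>M $ i $ j\<bar> | i j. True}"

definition mat_norm_frob :: "real^'n^'m \<Rightarrow> real" where
  "mat_norm_frob M = sqrt (\<Sum>i\<in>UNIV. \<Sum>j\<in>UNIV. (M $ i $ j)\<^sup>2)"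

definition symmetric_mat :: "real^'n^'n \<Rightarrow> bool" where
  "symmetric_mat M \<longleftrightarrow> transpose M = M"

definition pos_semidef :: "real^'n^'n \<Rightarrow> bool" where
  "pos_semidef M \<longleftrightarrow> symmetric_mat M \<and> (\<forall>v. 0 \<le> v \<bullet> (M *v v))"

text \<open>The arguments are the blocks in reading order: top left, top right, bottom left,
  bottom right.\<close>

definition block_mat ::
  "real^'c^'r \<Rightarrow> real^'d^'r \<Rightarrow> real^'c^'s \<Rightarrow> real^'d^'s \<Rightarrow> real^('c + 'd)^('r + 's)" where
  "block_mat P Q R S = (\<chi> i j.
     case i of
       Inl a \<Rightarrow> (case j of Inl b \<Rightarrow> P $ a $ b | Inr b \<Rightarrow> Q $ a $ b)
     | Inr a \<Rightarrow> (case j of Inl b \<Rightarrow> R $ a $ b | Inr b \<Rightarrow> S $ a $ b))"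

text \<open>Both suprema range over compact sets; the sets are nonempty when the kernel of \<open>A\<close> is
  nontrivial and \<open>k \<ge> 1\<close>, and the suprema are then maxima.\<close>

definition alpha :: "real^'n^'m \<Rightarrow> nat \<Rightarrow> real" where
  "alpha A k =
     (SUP x\<in>{x. A *v x = 0 \<and> vec_norm1 x = 1}.
        SUP y\<in>{y. infnorm y = 1 \<and> vec_norm1 y \<le> real k}. y \<bullet> x)"

definition sdp_feasible ::
  "real^'n^'m \<Rightarrow> nat \<Rightarrow> real^'n^'n \<Rightarrow> real^'n^'n \<Rightarrow> real^'n^'n \<Rightarrow> bool" where
  "sdp_feasible A k X Y Z \<longleftrightarrow>
     symmetric_mat X \<and> symmetric_mat Y \<and>
     A ** X ** transpose A = 0 \<and> mat_norm1 X \<le> 1 \<and>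
     mat_norm_inf Y \<le> 1 \<and> mat_norm1 Y \<le> (real k)\<^sup>2 \<and> mat_norm1 Z \<le> real k \<and>
     pos_semidef (block_mat X (transpose Z) Z Y)"

text \<open>The feasible set is compact and contains zero, so this supremum is the optimal value.\<close>

definition sdp_value :: "real^'n^'m \<Rightarrow> nat \<Rightarrow> real" where
  "sdp_value A k = Sup {trace Z | X Y Z. sdp_feasible A k X Y Z}"

definition sdp_optimal ::
  "real^'n^'m \<Rightarrow> nat \<Rightarrow> real^'n^'n \<Rightarrow> real^'n^'n \<Rightarrow> real^'n^'n \<Rightarrow> bool" where
  "sdp_optimal A k X Y Z \<longleftrightarrow>
     sdp_feasible A k X Y Z \<and>
     (\<forall>X' Y' Z'. sdp_feasible A k X' Y' Z' \<longrightarrow> trace Z' \<le> trace Z)"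

definition delta_val ::
  "real^'n^'n \<Rightarrow> real^'n^'n \<Rightarrow> real^'n^'n \<Rightarrow> real \<Rightarrow> real" where
  "delta_val X Y Z \<epsilon> = 3 + 3 * ((mat_norm_frob Z)\<^sup>2 + trace (X ** Y)) / \<epsilon>\<^sup>2"

definition g_fun :: "real^'n^'n \<Rightarrow> real \<Rightarrow> real" where
  "g_fun X \<delta> = (sqrt (2 / pi) + sqrt (2 * ln \<delta>)) * (\<Sum>i\<in>UNIV. sqrt (X $ i $ i))"

definition h_fun :: "real^'n^'n \<Rightarrow> nat \<Rightarrow> real \<Rightarrow> real" where
  "h_fun Y k \<delta> = max
     ((sqrt (2 * ln (2 * real CARD('n))) + sqrt (2 * ln \<delta>)) * Max {sqrt (Y $ i $ i) | i. True})
     ((sqrt (2 / pi) + sqrt (2 * ln \<delta>)) * (\<Sum>i\<in>UNIV. sqrt (Y $ i $ i)) / real k)"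

end

theory Submission
  imports Defs
begin

text \<open>
  The upper bound says that the semidefinite program is a relaxation: a pair \<open>(x, y)\<close> that is feasible
  for the maximization problem yields the feasible triple \<open>x x\<^sup>T\<close>, \<open>y y\<^sup>T\<close>, \<open>y x\<^sup>T\<close> with the same
  objective value (\<open>rank_one_sdp_feasible\<close>).

  The lower bound is a randomized rounding of an optimal solution. Write the positive semidefinite block
  matrix as a Gram matrix \<open>\<Sum>\<^sub>l u\<^sub>l u\<^sub>l\<^sup>T\<close> (\<open>psd_gram_factorization\<close>), draw independent random signs
  \<open>s\<^sub>l\<close>, and let \<open>x\<close> and \<open>y\<close> be the two halves of \<open>\<Sum>\<^sub>l s\<^sub>l u\<^sub>l\<close>. Then \<open>(x, y)\<close> has mean zero and the
  block matrix as its covariance. Consequently \<open>A x = 0\<close> for every choice of signs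
  (\<open>kernel_of_gram_columns\<close>), and \<open>y \<bullet> x\<close> has mean \<open>Tr Z\<close> and variance at most
  \<open>Tr (X Y) + \<parallel>Z\<parallel>\<^sub>F\<^sup>2\<close> (\<open>sign_mean_quadratic_form\<close>, \<open>gram_moments\<close>). By Cantelli's inequality
  \<open>y \<bullet> x \<ge> Tr Z - \<epsilon>\<close> fails with probability at most \<open>1 - 3 / \<delta>\<close>. The 1-norms of \<open>x\<close> and \<open>y\<close> and the
  maximum norm of \<open>y\<close> exceed the bounds that make up \<open>g_fun\<close> and \<open>h_fun\<close> with probability at most
  \<open>1 / \<delta>\<close> each, strictly less for the 1-norms. Hence some choice of signs satisfies all four requirements
  (\<open>exists_good_signs\<close>), and after rescaling the pair \<open>(x, y)\<close> witnesses the lower bound for \<open>alpha\<close>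
  (\<open>scaled_inner_le_alpha\<close>).

  The constants \<open>sqrt (2 / pi)\<close> and \<open>sqrt (2 * ln (2 * n))\<close> are the bounds for the expected norms of
  normal vectors with this covariance, but random signs do equally well and turn every expectation into
  a finite average. Linear forms in random signs have the subgaussian moment generating function
  (\<open>sign_mean_exp_le\<close>), convexity of \<open>exp\<close> extends the resulting tail bound from one coordinate to the
  1-norm, and the loss of a factor 2 compared with normal variables is made up for by the mixed term
  \<open>2 * sqrt (2 / pi) * sqrt (2 * ln \<delta>)\<close> in the square of the threshold (\<open>tail_constants\<close>).
\<close>

section \<open>Averages over sign vectors\<close>

definition sign_vectors :: "('l \<Rightarrow> real) set" where
  "sign_vectors = PiE UNIV (\<lambda>_. {-1, 1})"

text \<open>
  The expectation over a uniformly random sign vector. Probabilities are obtained as means of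
  indicator functions, which are written with \<open>of_bool\<close>.
\<close>

definition sign_mean :: "(('l::finite \<Rightarrow> real) \<Rightarrow> real) \<Rightarrow> real" where
  "sign_mean f = (\<Sum>s\<in>sign_vectors. f s) / 2 ^ CARD('l)"

lemma card_sign_vectors: "card (sign_vectors :: ('l::finite \<Rightarrow> real) set) = 2 ^ CARD('l)"
  unfolding sign_vectors_def by (subst card_PiE) (auto simp: numeral_2_eq_2)

lemma sign_vectors_square:
  assumes "s \<in> sign_vectors" shows "s l * s l = 1"
proof -
  have "s l \<in> {-1, 1}" using assms PiE_mem unfolding sign_vectors_def by blast
  then show ?thesis by auto
qed

lemma sign_mean_const: "sign_mean (\<lambda>s::'l::finite \<Rightarrow> real. c) = c"
  by (simp add: sign_mean_def card_sign_vectors)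

lemma sign_mean_add: "sign_mean (\<lambda>s. f s + g s) = sign_mean f + sign_mean g"
  by (simp add: sign_mean_def sum.distrib add_divide_distrib)

lemma sign_mean_cmult: "sign_mean (\<lambda>s. c * f s) = c * sign_mean f"
  by (simp add: sign_mean_def sum_distrib_left[symmetric])

lemma sign_mean_sum: "sign_mean (\<lambda>s. \<Sum>i\<in>I. f i s) = (\<Sum>i\<in>I. sign_mean (f i))"
  unfolding sign_mean_def by (subst sum.swap) (simp add: sum_divide_distrib)

lemma sign_mean_mono:
  assumes "\<And>s. s \<in> sign_vectors \<Longrightarrow> f s \<le> g s"
  shows "sign_mean f \<le> sign_mean g"
  unfolding sign_mean_def using assms by (intro divide_right_mono sum_mono) auto

lemma sign_mean_cong:
  assumes "\<And>s. s \<in> sign_vectors \<Longrightarrow> f s = g s"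
  shows "sign_mean f = sign_mean g"
  unfolding sign_mean_def using assms by simp

text \<open>
  Independence of the coordinates: expanding the product of the sums over the two signs of each
  coordinate produces one summand for every sign vector.
\<close>

lemma sign_mean_prod:
  fixes f :: "'l::finite \<Rightarrow> real \<Rightarrow> real"
  shows "sign_mean (\<lambda>s. \<Prod>l\<in>UNIV. f l (s l)) = (\<Prod>l\<in>UNIV. (f l (-1) + f l 1) / 2)"
  unfolding sign_mean_def sign_vectors_def
  by (subst prod_sum_PiE[symmetric]) (auto simp: prod_dividef)

text \<open>
  Flipping one coordinate is a bijection of the sign vectors, so the mean equals its own negative.
\<close>

lemma sign_mean_eq_0_if_odd:
  fixes f :: "('l::finite \<Rightarrow> real) \<Rightarrow> real"
  assumes odd: "\<And>s. s \<in> sign_vectors \<Longrightarrow> f (s(l := - s l)) = - f s"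
  shows "sign_mean f = 0"
proof -
  have "(\<Sum>s\<in>sign_vectors. f s) = (\<Sum>s\<in>sign_vectors. f (s(l := - s l)))"
    by (rule sum.reindex_bij_witness[where i = "\<lambda>s. s(l := - s l)" and j = "\<lambda>s. s(l := - s l)"])
      (auto simp: sign_vectors_def PiE_iff extensional_def)
  also have "\<dots> = - (\<Sum>s\<in>sign_vectors. f s)"
    using odd by (simp add: sum_negf)
  finally show ?thesis by (simp add: sign_mean_def)
qed

section \<open>Exponential tail bounds\<close>

lemma fact_double_ge: "2 ^ n * fact n \<le> (fact (2 * n) :: real)"
proof (induction n)
  case (Suc n)
  have "2 ^ Suc n * fact (Suc n) = (2 * real n + 2) * (2 ^ n * fact n)"
    by (simp add: algebra_simps)
  also have "\<dots> \<le> (2 * real n + 2) * fact (2 * n)"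
    using Suc by (intro mult_left_mono) auto
  also have "\<dots> \<le> (2 * real n + 2) * ((2 * real n + 1) * fact (2 * n))"
    by (intro mult_left_mono) (simp_all add: algebra_simps)
  also have "\<dots> = fact (2 * Suc n)"
    by (simp add: algebra_simps)
  finally show ?case .
qed simp

text \<open>
  Termwise comparison of the power series: the coefficients of \<open>a ^ (2 * n)\<close> are
  \<open>1 / fact (2 * n)\<close> on the left and \<open>1 / (2 ^ n * fact n)\<close> on the right.
\<close>

lemma cosh_le_exp_half_square: "cosh (a::real) \<le> exp (a\<^sup>2 / 2)"
proof -
  have 1: "(\<lambda>n. a ^ (2 * n) / fact (2 * n)) sums cosh a"
  proof -
    have "(\<lambda>n. if even n then a ^ n /\<^sub>R fact n else 0) sums cosh a"
      by (rule cosh_converges)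
    moreover have "strict_mono (\<lambda>n::nat. 2 * n)"
      by (simp add: strict_mono_def)
    ultimately have "(\<lambda>n. if even (2 * n) then a ^ (2 * n) /\<^sub>R fact (2 * n) else 0) sums cosh a"
      by (subst sums_mono_reindex[where g = "\<lambda>n. 2 * n"]) (auto elim!: evenE)
    then show ?thesis by (simp add: divide_inverse mult.commute)
  qed
  have 2: "(\<lambda>n. (a\<^sup>2 / 2) ^ n /\<^sub>R fact n) sums exp (a\<^sup>2 / 2)"
    by (rule exp_converges)
  show ?thesis
  proof (rule sums_le[OF _ 1 2])
    fix n
    have "a ^ (2 * n) / fact (2 * n) \<le> a ^ (2 * n) / (2 ^ n * fact n)"
      using fact_double_ge[of n] by (intro divide_left_mono) (auto simp: power_mult)
    also have "\<dots> = (a\<^sup>2 / 2) ^ n /\<^sub>R fact n"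
      by (simp add: power_mult power_divide power2_eq_square power_mult_distrib field_simps)
    finally show "a ^ (2 * n) / fact (2 * n) \<le> (a\<^sup>2 / 2) ^ n /\<^sub>R fact n" .
  qed
qed

text \<open>
  A sum of independent signs with coefficients \<open>a l\<close> is subgaussian: its moment generating function
  is a product of hyperbolic cosines, each dominated by that of a normal variable with
  variance \<open>(a l)\<^sup>2\<close>.
\<close>

lemma sign_mean_exp_le:
  fixes a :: "'l::finite \<Rightarrow> real"
  shows "sign_mean (\<lambda>s. exp (\<Sum>l\<in>UNIV. a l * s l)) \<le> exp ((\<Sum>l\<in>UNIV. (a l)\<^sup>2) / 2)"
proof -
  have "sign_mean (\<lambda>s. exp (\<Sum>l\<in>UNIV. a l * s l)) = (\<Prod>l\<in>UNIV. cosh (a l))"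
    using sign_mean_prod[of "\<lambda>l x. exp (a l * x)"]
    by (simp add: exp_sum cosh_field_def add.commute)
  also have "\<dots> \<le> (\<Prod>l\<in>UNIV. exp ((a l)\<^sup>2 / 2))"
    by (intro prod_mono) (auto simp: cosh_le_exp_half_square cosh_real_nonneg)
  also have "\<dots> = exp ((\<Sum>l\<in>UNIV. (a l)\<^sup>2) / 2)"
    by (simp add: exp_sum sum_divide_distrib)
  finally show ?thesis .
qed

text \<open>
  The factor 2 comes from \<open>exp \<bar>z\<bar> \<le> exp z + exp (- z)\<close>. As the bound
  concerns one linear form at a time, it may be averaged over correlated coordinates.
\<close>

lemma sign_mean_exp_abs_le:
  fixes a :: "'l::finite \<Rightarrow> real"
  assumes "(\<Sum>l\<in>UNIV. (a l)\<^sup>2) \<le> v"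
  shows "sign_mean (\<lambda>s. exp (r * \<bar>\<Sum>l\<in>UNIV. a l * s l\<bar>)) \<le> 2 * exp (r\<^sup>2 * v / 2)"
proof -
  have one: "sign_mean (\<lambda>s. exp (q * (\<Sum>l\<in>UNIV. a l * s l))) \<le> exp (r\<^sup>2 * v / 2)" if "q\<^sup>2 = r\<^sup>2" for q
  proof -
    have "sign_mean (\<lambda>s. exp (q * (\<Sum>l\<in>UNIV. a l * s l))) \<le> exp ((\<Sum>l\<in>UNIV. (q * a l)\<^sup>2) / 2)"
      using sign_mean_exp_le[of "\<lambda>l. q * a l"] by (simp add: sum_distrib_left mult.assoc)
    also have "\<dots> \<le> exp (r\<^sup>2 * v / 2)"
      using mult_left_mono[OF assms, of "r\<^sup>2"] that
      by (simp add: power_mult_distrib sum_distrib_left[symmetric])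
    finally show ?thesis .
  qed
  have "sign_mean (\<lambda>s. exp (r * \<bar>\<Sum>l\<in>UNIV. a l * s l\<bar>))
      \<le> sign_mean (\<lambda>s. exp (r * (\<Sum>l\<in>UNIV. a l * s l)) + exp (-r * (\<Sum>l\<in>UNIV. a l * s l)))"
    by (intro sign_mean_mono) (auto simp: abs_if)
  also have "\<dots> \<le> 2 * exp (r\<^sup>2 * v / 2)"
    using one[of r] one[of "-r"] by (simp add: sign_mean_add)
  finally show ?thesis .
qed

text \<open>
  A union bound over the coordinates. Each coordinate is controlled by the exponential Markov
  inequality with parameter \<open>r / \<tau>\<close>, the optimal one for variance \<open>\<tau>\<^sup>2\<close>.
\<close>

lemma sign_mean_max_tail:
  fixes a :: "'i::finite \<Rightarrow> 'l::finite \<Rightarrow> real"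
  assumes var: "\<And>i. (\<Sum>l\<in>UNIV. (a i l)\<^sup>2) \<le> \<tau>\<^sup>2" and "\<tau> > 0" "r \<ge> 0"
  shows "sign_mean (\<lambda>s. of_bool (\<exists>i. \<bar>\<Sum>l\<in>UNIV. a i l * s l\<bar> > r * \<tau>))
    \<le> 2 * real CARD('i) * exp (- r\<^sup>2 / 2)"
proof -
  define y where "y i s = (\<Sum>l\<in>UNIV. a i l * s l)" for i and s :: "'l \<Rightarrow> real"
  have "sign_mean (\<lambda>s. of_bool (\<exists>i. \<bar>y i s\<bar> > r * \<tau>))
      \<le> sign_mean (\<lambda>s. \<Sum>i\<in>UNIV. exp (- r\<^sup>2) * exp (r / \<tau> * \<bar>y i s\<bar>))"
  proof (rule sign_mean_mono)
    fix s :: "'l \<Rightarrow> real"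
    show "of_bool (\<exists>i. \<bar>y i s\<bar> > r * \<tau>) \<le> (\<Sum>i\<in>UNIV. exp (- r\<^sup>2) * exp (r / \<tau> * \<bar>y i s\<bar>))"
    proof (cases "\<exists>i. \<bar>y i s\<bar> > r * \<tau>")
      case True
      then obtain i where i: "\<bar>y i s\<bar> > r * \<tau>" by blast
      have "r * (r * \<tau>) \<le> r * \<bar>y i s\<bar>"
        using i \<open>r \<ge> 0\<close> by (intro mult_left_mono) auto
      then have "1 \<le> exp (- r\<^sup>2) * exp (r / \<tau> * \<bar>y i s\<bar>)"
        using \<open>\<tau> > 0\<close> by (simp add: exp_add[symmetric] field_simps power2_eq_square)
      also have "\<dots> \<le> (\<Sum>i\<in>UNIV. exp (- r\<^sup>2) * exp (r / \<tau> * \<bar>y i s\<bar>))"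
        by (rule member_le_sum) auto
      finally show ?thesis by (simp add: True)
    qed (simp add: sum_nonneg)
  qed
  also have "\<dots> = (\<Sum>i\<in>UNIV. exp (- r\<^sup>2) * sign_mean (\<lambda>s. exp (r / \<tau> * \<bar>y i s\<bar>)))"
    by (simp add: sign_mean_sum sign_mean_cmult)
  also have "\<dots> \<le> (\<Sum>i\<in>(UNIV::'i set). exp (- r\<^sup>2) * (2 * exp ((r / \<tau>)\<^sup>2 * \<tau>\<^sup>2 / 2)))"
    unfolding y_def using var by (intro sum_mono mult_left_mono sign_mean_exp_abs_le) auto
  also have "\<dots> = 2 * real CARD('i) * (exp (- r\<^sup>2) * exp (r\<^sup>2 / 2))"
    using \<open>\<tau> > 0\<close> by (simp add: power_divide)
  also have "exp (- r\<^sup>2) * exp (r\<^sup>2 / 2) = exp (- r\<^sup>2 / 2)"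
    by (simp add: exp_add[symmetric])
  finally show ?thesis unfolding y_def .
qed

text \<open>
  The sum of the absolute values has the same tail as a single coordinate, up to scale. Writing the
  coordinates as \<open>\<sigma> i * z i\<close> with \<open>z i\<close> of variance at most 1, the quotient of the sum by \<open>sum \<sigma> UNIV\<close> is
  a convex combination of the \<open>\<bar>z i\<bar>\<close>; by convexity of \<open>exp\<close> the moment generating function of that
  quotient is at most the average of those of the \<open>\<bar>z i\<bar>\<close>, whatever their correlations. This replaces
  the concentration inequality for Lipschitz functions of a random vector.
\<close>

lemma sign_mean_norm1_tail:
  fixes a :: "'i::finite \<Rightarrow> 'l::finite \<Rightarrow> real"
  assumes var: "\<And>i. (\<Sum>l\<in>UNIV. (a i l)\<^sup>2) = (\<sigma> i)\<^sup>2" and \<sigma>: "\<And>i. \<sigma> i \<ge> 0"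
    and S: "(\<Sum>i\<in>UNIV. \<sigma> i) > 0" and "r \<ge> 0"
  shows "sign_mean (\<lambda>s. of_bool ((\<Sum>i\<in>UNIV. \<bar>\<Sum>l\<in>UNIV. a i l * s l\<bar>) > r * (\<Sum>i\<in>UNIV. \<sigma> i)))
    \<le> 2 * exp (- r\<^sup>2 / 2)"
proof -
  define S where "S = (\<Sum>i\<in>UNIV. \<sigma> i)"
  define b where "b i l = a i l / \<sigma> i" for i l
  define z where "z i s = (\<Sum>l\<in>UNIV. b i l * s l)" for i and s :: "'l \<Rightarrow> real"
  have "S > 0" using S by (simp add: S_def)
  have b: "(\<Sum>l\<in>UNIV. (b i l)\<^sup>2) \<le> 1" for i
  proof -
    have "(\<Sum>l\<in>UNIV. (b i l)\<^sup>2) = (\<sigma> i)\<^sup>2 / (\<sigma> i)\<^sup>2"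
      by (simp add: b_def power_divide sum_divide_distrib[symmetric] var)
    then show ?thesis by simp
  qed
  \<comment> \<open>If \<open>\<sigma> i = 0\<close>, division by zero makes \<open>b i\<close> vanish, and the variance condition makes \<open>a i\<close> vanish too.\<close>
  have ab: "a i l = \<sigma> i * b i l" for i l
  proof (cases "\<sigma> i = 0")
    case True
    then have "(\<Sum>l\<in>UNIV. (a i l)\<^sup>2) = 0"
      by (simp add: var)
    then have "a i l = 0"
      by (simp add: sum_nonneg_eq_0_iff)
    then show ?thesis using True by simp
  qed (simp add: b_def)
  have x: "\<bar>\<Sum>l\<in>UNIV. a i l * s l\<bar> = \<sigma> i * \<bar>z i s\<bar>" for i s
    by (simp add: ab z_def mult.assoc sum_distrib_left[symmetric] abs_mult \<sigma>)
  have w: "(\<Sum>i\<in>UNIV. \<sigma> i / S) = 1"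
    using \<open>S > 0\<close> by (simp add: sum_divide_distrib[symmetric] S_def)
  have "sign_mean (\<lambda>s. of_bool ((\<Sum>i\<in>UNIV. \<bar>\<Sum>l\<in>UNIV. a i l * s l\<bar>) > r * S))
      \<le> sign_mean (\<lambda>s. \<Sum>i\<in>UNIV. exp (- r\<^sup>2) * \<sigma> i / S * exp (r * \<bar>z i s\<bar>))"
  proof (rule sign_mean_mono)
    fix s :: "'l \<Rightarrow> real"
    show "of_bool ((\<Sum>i\<in>UNIV. \<bar>\<Sum>l\<in>UNIV. a i l * s l\<bar>) > r * S)
      \<le> (\<Sum>i\<in>UNIV. exp (- r\<^sup>2) * \<sigma> i / S * exp (r * \<bar>z i s\<bar>))"
    proof (cases "(\<Sum>i\<in>UNIV. \<bar>\<Sum>l\<in>UNIV. a i l * s l\<bar>) > r * S")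
      case True
      then have "r * S < (\<Sum>i\<in>UNIV. \<sigma> i * \<bar>z i s\<bar>)" by (simp add: x)
      then have "r < (\<Sum>i\<in>UNIV. \<sigma> i / S * \<bar>z i s\<bar>)"
        using \<open>S > 0\<close> by (simp add: sum_divide_distrib[symmetric] field_simps)
      then have "r * r \<le> r * (\<Sum>i\<in>UNIV. \<sigma> i / S * \<bar>z i s\<bar>)"
        using \<open>r \<ge> 0\<close> by (intro mult_left_mono) auto
      then have "exp (r\<^sup>2) \<le> exp (\<Sum>i\<in>UNIV. (\<sigma> i / S) *\<^sub>R (r * \<bar>z i s\<bar>))"
        by (simp add: power2_eq_square sum_distrib_left mult_ac)
      also have "\<dots> \<le> (\<Sum>i\<in>UNIV. \<sigma> i / S * exp (r * \<bar>z i s\<bar>))"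
        by (rule convex_on_sum[OF _ _ exp_convex w]) (use \<sigma> \<open>S > 0\<close> in auto)
      finally have "exp (- r\<^sup>2) * exp (r\<^sup>2) \<le> exp (- r\<^sup>2) * (\<Sum>i\<in>UNIV. \<sigma> i / S * exp (r * \<bar>z i s\<bar>))"
        by (rule mult_left_mono) simp
      then show ?thesis
        by (simp add: True exp_add[symmetric] sum_distrib_left mult.assoc)
    qed (use \<sigma> \<open>S > 0\<close> in \<open>auto intro!: sum_nonneg\<close>)
  qed
  also have "\<dots> = (\<Sum>i\<in>UNIV. exp (- r\<^sup>2) * \<sigma> i / S * sign_mean (\<lambda>s. exp (r * \<bar>z i s\<bar>)))"
    by (simp only: sign_mean_sum sign_mean_cmult)
  also have "\<dots> \<le> (\<Sum>i\<in>UNIV. exp (- r\<^sup>2) * \<sigma> i / S * (2 * exp (r\<^sup>2 * 1 / 2)))"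
    unfolding z_def using \<sigma> \<open>S > 0\<close> b
    by (intro sum_mono mult_left_mono sign_mean_exp_abs_le) auto
  also have "\<dots> = (\<Sum>i\<in>UNIV. \<sigma> i / S) * (2 * (exp (- r\<^sup>2) * exp (r\<^sup>2 / 2)))"
    by (simp add: sum_distrib_right sum_distrib_left mult_ac)
  also have "\<dots> = 2 * exp (- r\<^sup>2 / 2)"
    by (simp add: w exp_add[symmetric])
  finally show ?thesis unfolding S_def .
qed

section \<open>Mean and variance of a quadratic form in random signs\<close>

text \<open>
  The monomial is the constant 1 if every index occurs an even number of times; otherwise some index
  occurs exactly once, and the monomial is odd in it.
\<close>

lemma sign_mean_quartic:
  fixes i j k l :: "'l::finite"
  assumes "i \<noteq> j" "k \<noteq> l"
  shows "sign_mean (\<lambda>s. (s i * s j) * (s k * s l)) = of_bool (i = k \<and> j = l) + of_bool (i = l \<and> j = k)"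
proof (cases "(i = k \<and> j = l) \<or> (i = l \<and> j = k)")
  case True
  have "sign_mean (\<lambda>s. (s i * s j) * (s k * s l)) = sign_mean (\<lambda>s. (s i * s i) * (s j * s j))"
    using True by (auto simp: mult_ac)
  also have "\<dots> = sign_mean (\<lambda>s::'l \<Rightarrow> real. 1)"
    by (rule sign_mean_cong) (simp add: sign_vectors_square)
  finally show ?thesis using True assms by (auto simp: sign_mean_const)
next
  case False
  then consider "i \<notin> {k, l}" | "j \<notin> {k, l}" using assms by blast
  then have zero: "sign_mean (\<lambda>s. (s i * s j) * (s k * s l)) = 0"
  proof cases
    case 1
    then show ?thesis using assms by (intro sign_mean_eq_0_if_odd[where l = i]) auto
  next
    case 2
    then show ?thesis using assms by (intro sign_mean_eq_0_if_odd[where l = j]) auto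
  qed
  have "\<not> (i = k \<and> j = l)" "\<not> (i = l \<and> j = k)" using False by blast+
  then show ?thesis by (simp only: zero of_bool_eq(1) add_0_left)
qed

text \<open>
  Since the squares of signs are 1, the diagonal of the form is constant and only the off-diagonal
  part contributes to the variance. The bound adds the nonnegative diagonal terms
  \<open>2 * (M i i)\<^sup>2\<close>, which makes it the variance of the same form in independent standard normal
  variables.
\<close>

lemma sign_mean_quadratic_form:
  fixes M :: "'l::finite \<Rightarrow> 'l \<Rightarrow> real"
  defines "D \<equiv> \<lambda>s. (\<Sum>i\<in>UNIV. \<Sum>j\<in>UNIV. M i j * (s i * s j)) - (\<Sum>i\<in>UNIV. M i i)"
  shows "sign_mean D = 0"
    and "sign_mean (\<lambda>s. (D s)\<^sup>2) \<le> (\<Sum>i\<in>UNIV. \<Sum>j\<in>UNIV. (M i j)\<^sup>2 + M i j * M j i)"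
proof -
  define P where "P i j = (if i = j then 0 else M i j)" for i j
  have D: "D s = (\<Sum>i\<in>UNIV. \<Sum>j\<in>UNIV. P i j * (s i * s j))" if s: "s \<in> sign_vectors" for s
  proof -
    have "M i j * (s i * s j) = P i j * (s i * s j) + (if i = j then M i i else 0)" for i j
      using sign_vectors_square[OF s] by (simp add: P_def)
    then show ?thesis
      by (simp add: D_def sum.distrib)
  qed
  have two: "sign_mean (\<lambda>s. P i j * (s i * s j)) = 0" for i j
  proof (cases "i = j")
    case False
    then show ?thesis by (intro sign_mean_eq_0_if_odd[where l = i]) auto
  qed (simp add: P_def sign_mean_const)
  have "sign_mean D = sign_mean (\<lambda>s. \<Sum>i\<in>UNIV. \<Sum>j\<in>UNIV. P i j * (s i * s j))"
    by (rule sign_mean_cong) (rule D)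
  also have "\<dots> = 0" by (simp add: sign_mean_sum two)
  finally show "sign_mean D = 0" .
  have four: "sign_mean (\<lambda>s. P i j * (s i * s j) * (P k l * (s k * s l)))
    = P i j * P k l * (of_bool (i = k \<and> j = l) + of_bool (i = l \<and> j = k))" for i j k l
  proof (cases "i = j \<or> k = l")
    case True
    then have "P i j = 0 \<or> P k l = 0" by (auto simp: P_def)
    then have "P i j * (s i * s j) * (P k l * (s k * s l)) = 0" "P i j * P k l = 0" for s :: "'l \<Rightarrow> real"
      by auto
    then show ?thesis by (simp only: sign_mean_const mult_zero_left)
  next
    case False
    have "sign_mean (\<lambda>s. P i j * (s i * s j) * (P k l * (s k * s l)))
      = P i j * P k l * sign_mean (\<lambda>s. (s i * s j) * (s k * s l))"
      by (simp add: sign_mean_cmult[symmetric] mult_ac)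
    then show ?thesis using False by (simp add: sign_mean_quartic)
  qed
  have inner: "(\<Sum>k\<in>UNIV. \<Sum>l\<in>UNIV. P i j * P k l * (of_bool (i = k \<and> j = l) + of_bool (i = l \<and> j = k)))
    = P i j * P i j + P i j * P j i" for i j
  proof -
    have "P i j * P k l * (of_bool (i = k \<and> j = l) + of_bool (i = l \<and> j = k))
      = (if k = i then if l = j then P i j * P i j else 0 else 0)
        + (if k = j then if l = i then P i j * P j i else 0 else 0)" for k l
      by auto
    moreover have "(\<Sum>k\<in>UNIV. \<Sum>l\<in>UNIV. if k = a then if l = b then c else 0 else 0) = c"
      for a b :: 'l and c :: real
    proof -
      have "(\<Sum>l\<in>UNIV. if k = a then if l = b then c else 0 else 0) = (if k = a then c else 0)" for k
        by simp
      then show ?thesis by simp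
    qed
    ultimately show ?thesis by (simp only: sum.distrib)
  qed
  have "sign_mean (\<lambda>s. (D s)\<^sup>2)
    = sign_mean (\<lambda>s. \<Sum>i\<in>UNIV. \<Sum>j\<in>UNIV. \<Sum>k\<in>UNIV. \<Sum>l\<in>UNIV. P i j * (s i * s j) * (P k l * (s k * s l)))"
    by (rule sign_mean_cong, simp only: D power2_eq_square sum_distrib_right)
      (simp only: sum_distrib_left)
  also have "\<dots> = (\<Sum>i\<in>UNIV. \<Sum>j\<in>UNIV. P i j * P i j + P i j * P j i)"
    by (simp only: sign_mean_sum four inner)
  also have "\<dots> \<le> (\<Sum>i\<in>UNIV. \<Sum>j\<in>UNIV. (M i j)\<^sup>2 + M i j * M j i)"
    by (intro sum_mono) (auto simp: P_def power2_eq_square)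
  finally show "sign_mean (\<lambda>s. (D s)\<^sup>2) \<le> (\<Sum>i\<in>UNIV. \<Sum>j\<in>UNIV. (M i j)\<^sup>2 + M i j * M j i)" .
qed

text \<open>
  The one-sided Chebyshev inequality. The two-sided one would only give \<open>V / \<epsilon>\<^sup>2\<close>, which need not be
  smaller than 1.
\<close>

lemma sign_mean_cantelli:
  fixes D :: "('l::finite \<Rightarrow> real) \<Rightarrow> real"
  assumes mean: "sign_mean D = 0" and var: "sign_mean (\<lambda>s. (D s)\<^sup>2) \<le> V"
    and "V \<ge> 0" "\<epsilon> > 0"
  shows "sign_mean (\<lambda>s. of_bool (D s < - \<epsilon>)) \<le> V / (V + \<epsilon>\<^sup>2)"
proof -
  \<comment> \<open>This shift minimises the bound \<open>(V + u\<^sup>2) / (\<epsilon> + u)\<^sup>2\<close>.\<close>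
  define u where "u = V / \<epsilon>"
  have u: "u \<ge> 0" "\<epsilon> + u > 0" using assms by (auto simp: u_def add_pos_nonneg)
  have "sign_mean (\<lambda>s. of_bool (D s < - \<epsilon>)) \<le> sign_mean (\<lambda>s. (1 / (\<epsilon> + u)\<^sup>2) * ((D s)\<^sup>2 + (- 2 * u * D s + u\<^sup>2)))"
  proof (rule sign_mean_mono)
    fix s
    have sq: "(D s)\<^sup>2 + (- 2 * u * D s + u\<^sup>2) = (u - D s)\<^sup>2" by (simp add: power2_eq_square algebra_simps)
    show "of_bool (D s < - \<epsilon>) \<le> (1 / (\<epsilon> + u)\<^sup>2) * ((D s)\<^sup>2 + (- 2 * u * D s + u\<^sup>2))"
    proof (cases "D s < - \<epsilon>")
      case True
      then have "(\<epsilon> + u)\<^sup>2 \<le> (u - D s)\<^sup>2" using u by (intro power_mono) auto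
      then show ?thesis using True u unfolding sq by (simp add: divide_simps)
    qed (use sq in simp)
  qed
  also have "\<dots> = (1 / (\<epsilon> + u)\<^sup>2) * (sign_mean (\<lambda>s. (D s)\<^sup>2) + u\<^sup>2)"
    by (simp only: sign_mean_cmult sign_mean_add mean sign_mean_const mult_zero_right add_0)
  also have "\<dots> \<le> (1 / (\<epsilon> + u)\<^sup>2) * (V + u\<^sup>2)"
    using var by (intro mult_left_mono) auto
  also have "\<dots> = V / (V + \<epsilon>\<^sup>2)"
  proof -
    have e: "\<epsilon> + u = (V + \<epsilon>\<^sup>2) / \<epsilon>" "V + u\<^sup>2 = V * (V + \<epsilon>\<^sup>2) / \<epsilon>\<^sup>2"
      using \<open>\<epsilon> > 0\<close> by (auto simp: u_def field_simps power2_eq_square)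
    have "1 / (w / \<epsilon>)\<^sup>2 * (V * w / \<epsilon>\<^sup>2) = V / w" if "w > 0" for w
      using that \<open>\<epsilon> > 0\<close> by (simp add: power2_eq_square)
    moreover have "V + \<epsilon>\<^sup>2 > 0" using assms by (simp add: add_nonneg_pos)
    ultimately show ?thesis unfolding e by blast
  qed
  finally show ?thesis .
qed

section \<open>Gram factorization of positive semidefinite matrices\<close>

text \<open>
  Both parts are needed for a pivot \<open>p\<close> of a positive semidefinite form: the first says that the Schur
  complement remains positive semidefinite, and with division by zero it is also correct at \<open>p = 0\<close>; the
  second says that a zero pivot has a zero row.
\<close>

lemma nonneg_quadratic_discriminant:
  fixes p q r :: real
  assumes "\<And>t. 0 \<le> t\<^sup>2 * p + 2 * t * q + r"
  shows "q\<^sup>2 / p \<le> r" and "p = 0 \<Longrightarrow> q = 0"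
proof -
  have r: "0 \<le> r" using assms[of 0] by simp
  show "q\<^sup>2 / p \<le> r"
  proof (cases "p = 0")
    case False
    then have "(- q / p)\<^sup>2 * p + 2 * (- q / p) * q + r = r - q\<^sup>2 / p"
      by (simp add: field_simps power2_eq_square)
    then show ?thesis using assms[of "- q / p"] by simp
  qed (simp add: r)
  show "q = 0" if "p = 0"
  proof (rule ccontr)
    assume "q \<noteq> 0"
    then show False using assms[of "- (r + 1) / (2 * q)"] that r by (simp add: field_simps)
  qed
qed

text \<open>
  Cholesky factorization by induction on the index set: remove one index \<open>a\<close>, factorize the Schur
  complement \<open>C\<close> of the pivot \<open>W a a\<close>, and add the rank-one matrix of the vector
  \<open>W a i / sqrt (W a a)\<close>. The vectors are indexed by the index set itself, so that there are as many
  vectors as rows.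
\<close>

lemma psd_gram_factorization:
  fixes W :: "'a \<Rightarrow> 'a \<Rightarrow> real"
  assumes "finite F"
    and "\<And>i j. i \<in> F \<Longrightarrow> j \<in> F \<Longrightarrow> W i j = W j i"
    and "\<And>v. 0 \<le> (\<Sum>i\<in>F. \<Sum>j\<in>F. v i * W i j * v j)"
  shows "\<exists>u. \<forall>i\<in>F. \<forall>j\<in>F. W i j = (\<Sum>l\<in>F. u l i * u l j)"
  using assms
proof (induction F arbitrary: W rule: finite_induct)
  case empty
  then show ?case by simp
next
  case (insert a F)
  define p where "p = W a a"
  define q where "q v = (\<Sum>j\<in>F. W a j * v j)" for v
  define r where "r v = (\<Sum>i\<in>F. \<Sum>j\<in>F. v i * W i j * v j)" for v
  note sym = insert.prems(1)
  have form: "0 \<le> t\<^sup>2 * p + 2 * t * q v + r v" for t v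
  proof -
    define w where "w = v(a := t)"
    have w: "w a = t" "\<And>j. j \<in> F \<Longrightarrow> w j = v j" using insert.hyps by (auto simp: w_def)
    have "(\<Sum>i\<in>F. w i * W i a * w a) = (\<Sum>i\<in>F. t * (W a i * v i))"
      using w sym by (intro sum.cong) (auto simp: mult_ac)
    then have 1: "(\<Sum>i\<in>F. w i * W i a * w a) = t * q v"
      by (simp add: q_def sum_distrib_left)
    have "(\<Sum>j\<in>F. w a * W a j * w j) = (\<Sum>j\<in>F. t * (W a j * v j))"
      using w by (intro sum.cong) (auto simp: mult_ac)
    then have 2: "(\<Sum>j\<in>F. w a * W a j * w j) = t * q v"
      by (simp add: q_def sum_distrib_left)
    have 3: "(\<Sum>i\<in>F. \<Sum>j\<in>F. w i * W i j * w j) = r v"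
      unfolding r_def by (intro sum.cong refl) (auto simp: w)
    have "0 \<le> (\<Sum>i\<in>insert a F. \<Sum>j\<in>insert a F. w i * W i j * w j)"
      by (rule insert.prems)
    also have "\<dots> = w a * W a a * w a + (\<Sum>j\<in>F. w a * W a j * w j)
        + ((\<Sum>i\<in>F. w i * W i a * w a) + (\<Sum>i\<in>F. \<Sum>j\<in>F. w i * W i j * w j))"
      using insert.hyps by (simp add: sum.distrib)
    finally show ?thesis
      unfolding 1 2 3 by (simp add: w p_def power2_eq_square mult_ac)
  qed
  have "0 \<le> p" using form[of 1 "\<lambda>_. 0"] by (simp add: q_def r_def)
  have row: "W a j = 0" if "p = 0" "j \<in> F" for j
  proof -
    define e where "e i = (if i = j then 1 else 0 :: real)" for i
    have "q e = (\<Sum>i\<in>F. if i = j then W a i else 0)"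
      unfolding q_def e_def by (intro sum.cong) auto
    then have "q e = W a j"
      using insert.hyps that by simp
    then show ?thesis using nonneg_quadratic_discriminant(2)[OF form[of _ e] \<open>p = 0\<close>] by simp
  qed
  define C where "C i j = W i j - W a i * W a j / p" for i j
  have "\<exists>u. \<forall>i\<in>F. \<forall>j\<in>F. C i j = (\<Sum>l\<in>F. u l i * u l j)"
  proof (rule insert.IH)
    fix i j assume "i \<in> F" "j \<in> F"
    then show "C i j = C j i" using sym by (simp add: C_def)
  next
    fix v
    have "(\<Sum>i\<in>F. \<Sum>j\<in>F. v i * C i j * v j)
      = r v - (\<Sum>i\<in>F. \<Sum>j\<in>F. (W a i * v i) * (W a j * v j) / p)"
      by (simp add: r_def C_def algebra_simps sum_subtractf)
    also have "\<dots> = r v - (q v)\<^sup>2 / p"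
      by (simp add: q_def power2_eq_square sum_product sum_divide_distrib)
    finally show "0 \<le> (\<Sum>i\<in>F. \<Sum>j\<in>F. v i * C i j * v j)"
      using nonneg_quadratic_discriminant(1)[OF form] by simp
  qed
  then obtain u where u: "\<And>i j. i \<in> F \<Longrightarrow> j \<in> F \<Longrightarrow> C i j = (\<Sum>l\<in>F. u l i * u l j)"
    by blast
  define u' where "u' l i = (if l = a then W a i / sqrt p else if i = a then 0 else u l i)" for l i
  have split: "(\<Sum>l\<in>insert a F. u' l i * u' l j) = W a i * W a j / p + (\<Sum>l\<in>F. u' l i * u' l j)" for i j
    using insert.hyps \<open>0 \<le> p\<close> by (simp add: u'_def)
  have "W i j = (\<Sum>l\<in>insert a F. u' l i * u' l j)" if "i \<in> insert a F" "j \<in> insert a F" for i j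
  proof (cases "i = a \<or> j = a")
    case True
    have "(\<Sum>l\<in>F. u' l i * u' l j) = 0"
      using True insert.hyps by (intro sum.neutral) (auto simp: u'_def)
    moreover have "W i j = W a i * W a j / p"
    proof (cases "p = 0")
      case True': True
      have "W a l = 0" if "l \<in> insert a F" for l
        using that row[OF True'] True' by (auto simp: p_def)
      then show ?thesis using True that sym[of i j] by auto
    next
      case False
      then show ?thesis using True that sym[of i j] by (auto simp: p_def)
    qed
    ultimately show ?thesis using split by simp
  next
    case False
    then have ij: "i \<in> F" "j \<in> F" using that by auto
    have "(\<Sum>l\<in>F. u' l i * u' l j) = C i j"
      unfolding u[OF ij] using False insert.hyps by (intro sum.cong) (auto simp: u'_def)
    then show ?thesis unfolding split by (simp add: C_def)
  qed
  then show ?case by blast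
qed

section \<open>The maximization problem\<close>

lemma infnorm_le_iff_cart: "infnorm (y :: real^'n) \<le> c \<longleftrightarrow> (\<forall>i. \<bar>y $ i\<bar> \<le> c)"
proof
  assume "infnorm y \<le> c"
  then show "\<forall>i. \<bar>y $ i\<bar> \<le> c" using component_le_infnorm_cart order_trans by blast
next
  assume "\<forall>i. \<bar>y $ i\<bar> \<le> c"
  then show "infnorm y \<le> c" unfolding infnorm_cart by (intro cSup_least) auto
qed

lemma vec_norm1_nonneg: "0 \<le> vec_norm1 x"
  by (simp add: vec_norm1_def sum_nonneg)

lemma vec_norm1_eq_0_iff: "vec_norm1 x = 0 \<longleftrightarrow> x = 0"
  by (simp add: vec_norm1_def sum_nonneg_eq_0_iff vec_eq_iff)

lemma vec_norm1_scaleR: "vec_norm1 (c *\<^sub>R x) = \<bar>c\<bar> * vec_norm1 x"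
  by (simp add: vec_norm1_def abs_mult sum_distrib_left)

lemma inner_le_infnorm_mult_norm1: "y \<bullet> x \<le> infnorm y * vec_norm1 (x :: real^'n)"
proof -
  have "y \<bullet> x \<le> (\<Sum>i\<in>UNIV. \<bar>y $ i\<bar> * \<bar>x $ i\<bar>)"
    unfolding inner_vec_def inner_real_def by (intro sum_mono) (simp flip: abs_mult)
  also have "\<dots> \<le> (\<Sum>i\<in>UNIV. infnorm y * \<bar>x $ i\<bar>)"
    by (intro sum_mono mult_right_mono component_le_infnorm_cart) auto
  finally show ?thesis by (simp add: vec_norm1_def sum_distrib_left)
qed

lemma inner_le_alpha:
  fixes A :: "real^'n^'m"
  assumes "A *v x = 0" "vec_norm1 x = 1" "infnorm y = 1" "vec_norm1 y \<le> real k"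
  shows "y \<bullet> x \<le> alpha A k"
proof -
  let ?Y = "{y :: real^'n. infnorm y = 1 \<and> vec_norm1 y \<le> real k}"
  have bound: "y' \<bullet> x' \<le> 1" if "y' \<in> ?Y" "vec_norm1 x' = 1" for x' y'
    using inner_le_infnorm_mult_norm1[of y' x'] that by simp
  have "y \<bullet> x \<le> (SUP y\<in>?Y. y \<bullet> x)"
    by (rule cSUP_upper) (use assms bound in \<open>auto intro!: bdd_aboveI2\<close>)
  also have "\<dots> \<le> alpha A k"
    unfolding alpha_def
  proof (rule cSUP_upper)
    show "bdd_above ((\<lambda>x. SUP y\<in>?Y. y \<bullet> x) ` {x. A *v x = 0 \<and> vec_norm1 x = 1})"
      by (rule bdd_aboveI2[of _ _ 1], rule cSUP_least) (use assms bound in auto)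
  qed (use assms in auto)
  finally show ?thesis .
qed

text \<open>
  The constraint \<open>infnorm y = 1\<close> may be relaxed to an inequality without increasing the maximum.
  Let \<open>j\<close> be a coordinate in which \<open>\<bar>x $ j\<bar>\<close> is largest. Raising \<open>\<bar>y $ j\<bar>\<close> to 1 and, if the
  budget \<open>k\<close> is exceeded, shrinking all other coordinates by a common factor \<open>c\<close> moves mass to the
  coordinate where it counts most, and removes no more mass elsewhere than it adds at \<open>j\<close>.
\<close>

lemma inner_le_inner_infnorm_eq_1:
  fixes x y :: "real^'n"
  assumes y: "infnorm y \<le> 1" "vec_norm1 y \<le> k" and k: "k \<ge> 1"
  obtains y' where "infnorm y' = 1" "vec_norm1 y' \<le> k" "y \<bullet> x \<le> y' \<bullet> x"
proof -
  have "Max (range (\<lambda>i. \<bar>x $ i\<bar>)) \<in> range (\<lambda>i. \<bar>x $ i\<bar>)"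
    by (rule Max_in) auto
  then obtain j where "Max (range (\<lambda>i. \<bar>x $ i\<bar>)) = \<bar>x $ j\<bar>"
    unfolding image_iff by blast
  then have j: "\<bar>x $ i\<bar> \<le> \<bar>x $ j\<bar>" for i
    by (metis Max_ge finite_imageI finite rangeI)
  define S where "S = (\<Sum>i\<in>UNIV - {j}. \<bar>y $ i\<bar>)"
  define c where "c = (if S \<le> k - 1 then 1 else (k - 1) / S)"
  define y' where "y' = (\<chi> i. if i = j then (if x $ j \<ge> 0 then 1 else - 1) else c * y $ i)"
  have abs_y: "\<bar>y $ i\<bar> \<le> 1" for i using y(1) by (simp add: infnorm_le_iff_cart)
  have S: "S \<ge> 0" "\<bar>y $ j\<bar> + S \<le> k"
    using y(2) by (auto simp: S_def sum_nonneg vec_norm1_def sum.remove[of _ j])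
  have c: "0 \<le> c" "c \<le> 1" "c * S \<le> k - 1" "(1 - c) * S \<le> 1 - \<bar>y $ j\<bar>"
    using S k abs_y[of j] by (auto simp: c_def field_simps)
  have comp: "\<bar>y' $ i\<bar> \<le> 1" for i
    using mult_le_one[OF c(2) _ abs_y[of i]] c(1) by (simp add: y'_def abs_mult)
  have "\<bar>y' $ j\<bar> = 1" by (simp add: y'_def)
  then have "infnorm y' = 1"
    using component_le_infnorm_cart[of y' j] comp infnorm_le_iff_cart[of y' 1] by simp
  moreover have "vec_norm1 y' \<le> k"
  proof -
    have "vec_norm1 y' = 1 + (\<Sum>i\<in>UNIV - {j}. c * \<bar>y $ i\<bar>)"
      using c(1) by (simp add: vec_norm1_def sum.remove[of _ j] y'_def abs_mult)
    then show ?thesis using c(3) by (simp add: S_def sum_distrib_left)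
  qed
  moreover have "y \<bullet> x \<le> y' \<bullet> x"
  proof -
    have 1: "y \<bullet> x - y' \<bullet> x = (y $ j * x $ j - \<bar>x $ j\<bar>) + (\<Sum>i\<in>UNIV - {j}. (1 - c) * (y $ i * x $ i))"
      by (simp add: inner_vec_def sum.remove[of _ j] y'_def sum_subtractf algebra_simps)
    have 2: "y $ j * x $ j \<le> \<bar>y $ j\<bar> * \<bar>x $ j\<bar>" by (simp flip: abs_mult)
    have "(\<Sum>i\<in>UNIV - {j}. (1 - c) * (y $ i * x $ i)) \<le> (\<Sum>i\<in>UNIV - {j}. (1 - c) * (\<bar>y $ i\<bar> * \<bar>x $ j\<bar>))"
    proof (intro sum_mono mult_left_mono)
      fix i
      have "y $ i * x $ i \<le> \<bar>y $ i\<bar> * \<bar>x $ i\<bar>" by (simp flip: abs_mult)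
      also have "\<dots> \<le> \<bar>y $ i\<bar> * \<bar>x $ j\<bar>" using j by (intro mult_left_mono) auto
      finally show "y $ i * x $ i \<le> \<bar>y $ i\<bar> * \<bar>x $ j\<bar>" .
    qed (use c in auto)
    also have "\<dots> = ((1 - c) * S) * \<bar>x $ j\<bar>"
      by (simp add: S_def sum_distrib_left sum_distrib_right mult_ac)
    also have "\<dots> \<le> (1 - \<bar>y $ j\<bar>) * \<bar>x $ j\<bar>"
      using c(4) by (rule mult_right_mono) simp
    finally show ?thesis using 1 2 by (simp add: algebra_simps)
  qed
  ultimately show ?thesis by (rule that)
qed

text \<open>
  How a rounded pair enters the maximization problem: \<open>g\<close> absorbs the normalisation of \<open>x\<close>, and \<open>h\<close>
  bounds both norms of \<open>y\<close>, the second one relative to its budget \<open>k\<close>.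
\<close>

lemma scaled_inner_le_alpha:
  fixes A :: "real^'n^'m"
  assumes Ax: "A *v x = 0" and "x \<noteq> 0" and x: "vec_norm1 x \<le> g"
    and y: "infnorm y \<le> h" "vec_norm1 y \<le> k * h" and "h > 0" "k \<ge> 1" "0 \<le> y \<bullet> x"
  shows "(y \<bullet> x) / (g * h) \<le> alpha A k"
proof -
  have pos: "vec_norm1 x > 0"
    using vec_norm1_nonneg[of x] \<open>x \<noteq> 0\<close> by (simp add: less_le vec_norm1_eq_0_iff)
  define u where "u = (1 / vec_norm1 x) *\<^sub>R x"
  have u: "A *v u = 0" "vec_norm1 u = 1"
    using pos Ax by (simp_all add: u_def matrix_vector_mult_scaleR vec_norm1_scaleR)
  have "infnorm ((1 / h) *\<^sub>R y) \<le> 1" "vec_norm1 ((1 / h) *\<^sub>R y) \<le> real k"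
    using y \<open>h > 0\<close> by (simp_all add: infnorm_mul vec_norm1_scaleR field_simps)
  then obtain w where w: "infnorm w = 1" "vec_norm1 w \<le> real k" "((1 / h) *\<^sub>R y) \<bullet> u \<le> w \<bullet> u"
    using inner_le_inner_infnorm_eq_1[of "(1 / h) *\<^sub>R y" "real k" u] \<open>k \<ge> 1\<close> by auto
  have "(y \<bullet> x) / (g * h) \<le> (y \<bullet> x) / (vec_norm1 x * h)"
    using assms pos by (intro divide_left_mono mult_right_mono mult_pos_pos) auto
  also have "\<dots> = ((1 / h) *\<^sub>R y) \<bullet> u" by (simp add: u_def)
  also have "\<dots> \<le> w \<bullet> u" by (rule w)
  also have "\<dots> \<le> alpha A k" using u w by (intro inner_le_alpha) auto
  finally show ?thesis .
qed

lemma nontrivial_kernel: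
  fixes A :: "real^'n^'m"
  assumes "CARD('n) > CARD('m)"
  obtains x where "A *v x = 0" "x \<noteq> 0"
  using matrix_nonfull_linear_equations_eq[of A] rank_bound[of A] assms that by auto

lemma alpha_nonneg:
  fixes A :: "real^'n^'m"
  assumes "CARD('n) > CARD('m)" "k \<ge> 1"
  shows "0 \<le> alpha A k"
proof -
  obtain x :: "real^'n" where "A *v x = 0" "x \<noteq> 0"
    using nontrivial_kernel[OF assms(1)] .
  then show ?thesis
    using scaled_inner_le_alpha[of A x "vec_norm1 x" 0 1 k] assms
    by (simp add: infnorm_0 vec_norm1_def)
qed

section \<open>The semidefinite relaxation\<close>

text \<open>
  The block matrix of this triple is \<open>w w\<^sup>T\<close> for the concatenation \<open>w\<close> of \<open>x\<close> and \<open>y\<close>, and its objective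
  value is \<open>y \<bullet> x\<close>. This is why the semidefinite program is a relaxation.
\<close>

lemma rank_one_sdp_feasible:
  fixes A :: "real^'n^'m"
  assumes Ax: "A *v x = 0" and x: "vec_norm1 x = 1" and y: "infnorm y = 1" "vec_norm1 y \<le> real k"
  shows "sdp_feasible A k (\<chi> i j. x $ i * x $ j) (\<chi> i j. y $ i * y $ j) (\<chi> i j. y $ i * x $ j)"
proof -
  have norm1: "mat_norm1 (\<chi> i j. u $ i * v $ j) = vec_norm1 u * vec_norm1 v" for u v :: "real^'n"
    by (simp add: mat_norm1_def vec_norm1_def sum_product abs_mult)
  have "A ** (\<chi> i j. x $ i * x $ j) = 0"
  proof -
    have "(A ** (\<chi> i j. x $ i * x $ j)) $ r $ j = (A *v x) $ r * x $ j" for r j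
      by (simp add: matrix_matrix_mult_def matrix_vector_mult_def sum_distrib_right mult.assoc)
    then show ?thesis by (simp add: Ax vec_eq_iff)
  qed
  then have AXA: "A ** (\<chi> i j. x $ i * x $ j) ** transpose A = 0"
    by (simp add: matrix_matrix_mult_def vec_eq_iff)
  have "Max {\<bar>(\<chi> i j. y $ i * y $ j) $ i $ j\<bar> |i j. True} \<le> 1"
  proof (rule Max.boundedI)
    have "{\<bar>(\<chi> i j. y $ i * y $ j) $ i $ j\<bar> |i j. True} = range (\<lambda>(i, j). \<bar>y $ i * y $ j\<bar>)"
      by auto
    then show "finite {\<bar>(\<chi> i j. y $ i * y $ j) $ i $ j\<bar> |i j. True}" by simp
  next
    fix a assume "a \<in> {\<bar>(\<chi> i j. y $ i * y $ j) $ i $ j\<bar> |i j. True}"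
    then obtain i j where "a = \<bar>y $ i\<bar> * \<bar>y $ j\<bar>" by (auto simp: abs_mult)
    then show "a \<le> 1"
      using component_le_infnorm_cart[of y] y(1) by (auto intro!: mult_le_one)
  qed auto
  then have inf: "mat_norm_inf (\<chi> i j. y $ i * y $ j) \<le> 1"
    by (simp add: mat_norm_inf_def)
  define w where "w = (\<chi> a. case a of Inl i \<Rightarrow> x $ i | Inr i \<Rightarrow> y $ i)"
  have block: "block_mat (\<chi> i j. x $ i * x $ j) (transpose (\<chi> i j. y $ i * x $ j))
     (\<chi> i j. y $ i * x $ j) (\<chi> i j. y $ i * y $ j) = (\<chi> a b. w $ a * w $ b)"
    by (auto simp: block_mat_def w_def vec_eq_iff transpose_def split: sum.split)
  have "v \<bullet> ((\<chi> a b. w $ a * w $ b) *v v) = (v \<bullet> w)\<^sup>2" for v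
    by (simp add: inner_vec_def matrix_vector_mult_def power2_eq_square sum_product sum_distrib_left mult_ac)
  then have psd: "pos_semidef (\<chi> a b. w $ a * w $ b)"
    by (simp add: pos_semidef_def symmetric_mat_def transpose_def mult.commute)
  have "vec_norm1 y * vec_norm1 y \<le> (real k)\<^sup>2"
    using y(2) by (simp add: power2_eq_square mult_mono vec_norm1_nonneg)
  moreover have "symmetric_mat (\<chi> i j. u $ i * u $ j)" for u :: "real^'n"
    by (simp add: symmetric_mat_def transpose_def mult.commute)
  ultimately show ?thesis
    unfolding sdp_feasible_def block using AXA inf psd x y(2) by (simp add: norm1)
qed

lemma sdp_value_eq_trace:
  assumes "sdp_optimal A k X Y Z"
  shows "sdp_value A k = trace Z"
  unfolding sdp_value_def using assms
  by (intro cSup_eq_maximum) (auto simp: sdp_optimal_def)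

lemma alpha_le_sdp_value:
  fixes A :: "real^'n^'m"
  assumes "CARD('n) > CARD('m)" "k \<ge> 1" and opt: "sdp_optimal A k X Y Z"
  shows "alpha A k \<le> sdp_value A k"
  unfolding alpha_def
proof (rule cSUP_least)
  obtain x :: "real^'n" where "A *v x = 0" "x \<noteq> 0"
    using nontrivial_kernel[OF assms(1)] .
  moreover have "vec_norm1 x \<noteq> 0" "0 \<le> vec_norm1 x"
    using \<open>x \<noteq> 0\<close> by (simp_all add: vec_norm1_eq_0_iff vec_norm1_nonneg)
  ultimately have "(1 / vec_norm1 x) *\<^sub>R x \<in> {x. A *v x = 0 \<and> vec_norm1 x = 1}"
    by (simp add: matrix_vector_mult_scaleR vec_norm1_scaleR)
  then show "{x. A *v x = 0 \<and> vec_norm1 x = 1} \<noteq> {}" by blast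
next
  fix x assume x: "x \<in> {x. A *v x = 0 \<and> vec_norm1 x = 1}"
  show "(SUP y\<in>{y. infnorm y = 1 \<and> vec_norm1 y \<le> real k}. y \<bullet> x) \<le> sdp_value A k"
  proof (rule cSUP_least)
    obtain y' :: "real^'n" where "infnorm y' = 1" "vec_norm1 y' \<le> real k"
      using inner_le_inner_infnorm_eq_1[of 0 "real k" x] \<open>k \<ge> 1\<close>
      by (auto simp: infnorm_0 vec_norm1_def)
    then show "{y :: real^'n. infnorm y = 1 \<and> vec_norm1 y \<le> real k} \<noteq> {}" by blast
  next
    fix y :: "real^'n" assume y: "y \<in> {y. infnorm y = 1 \<and> vec_norm1 y \<le> real k}"
    have "trace (\<chi> i j. y $ i * x $ j) \<le> trace Z"
      using rank_one_sdp_feasible[of A x y k] opt x y unfolding sdp_optimal_def by blast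
    then show "y \<bullet> x \<le> sdp_value A k"
      by (simp add: sdp_value_eq_trace[OF opt] trace_def inner_vec_def)
  qed
qed

text \<open>
  The diagonal entries of \<open>A X A\<^sup>T\<close> are sums over \<open>l\<close> of the squares of the entries of \<open>A x\<^sub>l\<close>. So every
  linear combination of the vectors \<open>x\<^sub>l\<close> lies in the kernel of \<open>A\<close>, and the rounding keeps the
  linear constraint exactly.
\<close>

lemma kernel_of_gram_columns:
  fixes A :: "real^'n^'m" and X :: "real^'n^'n" and x :: "'l::finite \<Rightarrow> 'n \<Rightarrow> real"
  assumes AXA: "A ** X ** transpose A = 0"
    and X: "\<And>i j. X $ i $ j = (\<Sum>l\<in>UNIV. x l i * x l j)"
  shows "A *v (\<chi> i. x l i) = 0"
proof -
  have "((A *v (\<chi> i. x l i)) $ r)\<^sup>2 = 0" for r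
  proof -
    define p where "p l = (\<Sum>i\<in>UNIV. A $ r $ i * x l i)" for l
    have "0 = (A ** X ** transpose A) $ r $ r" by (simp add: AXA)
    also have "\<dots> = (\<Sum>j\<in>UNIV. \<Sum>i\<in>UNIV. \<Sum>l\<in>UNIV. (A $ r $ i * x l i) * (A $ r $ j * x l j))"
      by (simp add: matrix_matrix_mult_def transpose_def X sum_distrib_left sum_distrib_right mult_ac)
    also have "\<dots> = (\<Sum>j\<in>UNIV. \<Sum>l\<in>UNIV. \<Sum>i\<in>UNIV. (A $ r $ i * x l i) * (A $ r $ j * x l j))"
      by (rule sum.cong[OF refl], rule sum.swap)
    also have "\<dots> = (\<Sum>l\<in>UNIV. \<Sum>j\<in>UNIV. \<Sum>i\<in>UNIV. (A $ r $ i * x l i) * (A $ r $ j * x l j))"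
      by (rule sum.swap)
    also have "\<dots> = (\<Sum>l\<in>UNIV. (p l)\<^sup>2)"
      by (simp add: p_def power2_eq_square sum_product mult_ac)
    finally have "(p l)\<^sup>2 = 0" by (simp add: sum_nonneg_eq_0_iff)
    then show ?thesis by (simp add: p_def matrix_vector_mult_def)
  qed
  then show ?thesis by (simp add: vec_eq_iff)
qed

section \<open>Randomized rounding\<close>

text \<open>
  In \<open>(c + t)\<^sup>2 / 2\<close> with \<open>t = sqrt (2 * ln \<delta>)\<close>, the term \<open>t\<^sup>2 / 2\<close> yields the factor \<open>1 / \<delta>\<close>, and
  the rest has to pay for the factor in front. For \<open>c = sqrt (2 / pi)\<close> the mixed term \<open>c * t\<close> exceeds 1,
  because \<open>ln \<delta> \<ge> 1\<close> and \<open>pi < 4\<close>, and so it pays for the factor 2. For \<open>c = sqrt (2 * ln (2 * n))\<close> the term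
  \<open>c\<^sup>2 / 2\<close> pays for the factor \<open>2 * n\<close>.
\<close>

lemma tail_constants:
  assumes "\<delta> \<ge> 3" and "n \<ge> 1"
  shows "2 * exp (- (sqrt (2 / pi) + sqrt (2 * ln \<delta>))\<^sup>2 / 2) < 1 / \<delta>"
    and "2 * n * exp (- (sqrt (2 * ln (2 * n)) + sqrt (2 * ln \<delta>))\<^sup>2 / 2) \<le> 1 / \<delta>"
proof -
  have ln_\<delta>: "1 \<le> ln \<delta>"
    using exp_le assms(1) by (subst ln_ge_iff) auto
  have tail: "exp (- (c + sqrt (2 * ln \<delta>))\<^sup>2 / 2) = exp (- (c\<^sup>2 / 2 + c * sqrt (2 * ln \<delta>))) * (1 / \<delta>)"
    for c
  proof -
    have "- (c + sqrt (2 * ln \<delta>))\<^sup>2 / 2 = - (c\<^sup>2 / 2 + c * sqrt (2 * ln \<delta>)) + - ln \<delta>"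
    proof -
      have "- (c + t)\<^sup>2 / 2 = - (c\<^sup>2 / 2 + c * t) + - (t\<^sup>2 / 2)" for t
        by (simp add: power2_eq_square field_simps)
      moreover have "(sqrt (2 * ln \<delta>))\<^sup>2 / 2 = ln \<delta>" using ln_\<delta> by simp
      ultimately show ?thesis by metis
    qed
    also have "exp \<dots> = exp (- (c\<^sup>2 / 2 + c * sqrt (2 * ln \<delta>))) * (1 / \<delta>)"
    proof -
      have "exp (y + - ln \<delta>) = exp y * (1 / \<delta>)" for y
        using assms(1) by (simp add: exp_diff)
      then show ?thesis .
    qed
    finally show ?thesis .
  qed
  show "2 * exp (- (sqrt (2 / pi) + sqrt (2 * ln \<delta>))\<^sup>2 / 2) < 1 / \<delta>"
  proof -
    have "4 * 1 \<le> 4 * ln \<delta>" using ln_\<delta> by simp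
    then have "1 < 2 / pi * (2 * ln \<delta>)"
      using pi_less_4 by (simp add: field_simps)
    then have "1 < sqrt (2 / pi) * sqrt (2 * ln \<delta>)"
      by (simp flip: real_sqrt_mult)
    then have "ln 2 < (sqrt (2 / pi))\<^sup>2 / 2 + sqrt (2 / pi) * sqrt (2 * ln \<delta>)"
    proof -
      have "0 \<le> (sqrt (2 / pi))\<^sup>2 / 2" by simp
      with \<open>1 < sqrt (2 / pi) * sqrt (2 * ln \<delta>)\<close> ln_2_less_1 show ?thesis by linarith
    qed
    then have "exp (- ((sqrt (2 / pi))\<^sup>2 / 2 + sqrt (2 / pi) * sqrt (2 * ln \<delta>))) < exp (- ln 2)"
      by simp
    then have "2 * exp (- ((sqrt (2 / pi))\<^sup>2 / 2 + sqrt (2 / pi) * sqrt (2 * ln \<delta>))) < 1"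
      by (simp add: exp_minus)
    then have "(2 * exp (- ((sqrt (2 / pi))\<^sup>2 / 2 + sqrt (2 / pi) * sqrt (2 * ln \<delta>)))) * (1 / \<delta>) < 1 * (1 / \<delta>)"
      using assms(1) by (intro mult_strict_right_mono) auto
    then show ?thesis unfolding tail by (simp only: mult.assoc mult_1)
  qed
  show "2 * n * exp (- (sqrt (2 * ln (2 * n)) + sqrt (2 * ln \<delta>))\<^sup>2 / 2) \<le> 1 / \<delta>"
  proof -
    let ?c = "sqrt (2 * ln (2 * n))"
    have "0 \<le> ln (2 * n)" using assms(2) by simp
    then have "ln (2 * n) \<le> ?c\<^sup>2 / 2 + ?c * sqrt (2 * ln \<delta>)" using ln_\<delta> by simp
    then have "exp (- (?c\<^sup>2 / 2 + ?c * sqrt (2 * ln \<delta>))) \<le> exp (- ln (2 * n))" by simp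
    then have "2 * n * exp (- (?c\<^sup>2 / 2 + ?c * sqrt (2 * ln \<delta>))) \<le> 1"
      using assms(2) by (simp add: exp_minus field_simps)
    then have "(2 * n * exp (- (?c\<^sup>2 / 2 + ?c * sqrt (2 * ln \<delta>)))) * (1 / \<delta>) \<le> 1 * (1 / \<delta>)"
      using assms(1) by (intro mult_right_mono) auto
    then show ?thesis unfolding tail by (simp only: mult.assoc mult_1)
  qed
qed

text \<open>
  Four bad events have to be avoided: \<open>x\<close> has a large 1-norm, \<open>y\<close> has a large 1-norm, \<open>y\<close> has a
  large entry, or the inner product falls below its mean by more than \<open>\<epsilon>\<close>. Each of the first three has
  probability at most \<open>1 / \<delta>\<close>, the first two strictly less, and the last one at most \<open>V / (V + \<epsilon>\<^sup>2)\<close>. The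
  value of \<open>\<delta>\<close> makes \<open>3 / \<delta> + V / (V + \<epsilon>\<^sup>2)\<close> exactly 1, and by strictness some sign vector avoids
  all four.
\<close>

lemma exists_good_signs:
  fixes a b :: "'n::finite \<Rightarrow> 'l::finite \<Rightarrow> real" and \<sigma> \<tau> :: "'n \<Rightarrow> real"
  defines "x \<equiv> \<lambda>s i. \<Sum>l\<in>UNIV. a i l * s l" and "y \<equiv> \<lambda>s i. \<Sum>l\<in>UNIV. b i l * s l"
    and "M \<equiv> \<lambda>l m. \<Sum>i\<in>UNIV. a i l * b i m"
  assumes \<sigma>: "\<And>i. \<sigma> i \<ge> 0" "\<And>i. (\<Sum>l\<in>UNIV. (a i l)\<^sup>2) = (\<sigma> i)\<^sup>2" "sum \<sigma> UNIV > 0"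
    and \<tau>: "\<And>i. \<tau> i \<ge> 0" "\<And>i. (\<Sum>l\<in>UNIV. (b i l)\<^sup>2) = (\<tau> i)\<^sup>2" "sum \<tau> UNIV > 0"
    and \<tau>_max: "\<And>i. \<tau> i \<le> \<tau>\<^sub>m"
    and V: "(\<Sum>l\<in>UNIV. \<Sum>m\<in>UNIV. (M l m)\<^sup>2 + M l m * M m l) \<le> V" "V \<ge> 0" and "\<epsilon> > 0"
    and \<delta>: "\<delta> = 3 + 3 * V / \<epsilon>\<^sup>2"
  obtains s where "s \<in> sign_vectors"
    and "(\<Sum>i\<in>UNIV. \<bar>x s i\<bar>) \<le> (sqrt (2 / pi) + sqrt (2 * ln \<delta>)) * sum \<sigma> UNIV"
    and "(\<Sum>i\<in>UNIV. \<bar>y s i\<bar>) \<le> (sqrt (2 / pi) + sqrt (2 * ln \<delta>)) * sum \<tau> UNIV"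
    and "\<And>i. \<bar>y s i\<bar> \<le> (sqrt (2 * ln (2 * real CARD('n))) + sqrt (2 * ln \<delta>)) * \<tau>\<^sub>m"
    and "(\<Sum>l\<in>UNIV. M l l) - \<epsilon> \<le> (\<Sum>i\<in>UNIV. x s i * y s i)"
proof -
  define r where "r = sqrt (2 / pi) + sqrt (2 * ln \<delta>)"
  define r' where "r' = sqrt (2 * ln (2 * real CARD('n))) + sqrt (2 * ln \<delta>)"
  define D where "D s = (\<Sum>l\<in>UNIV. \<Sum>m\<in>UNIV. M l m * (s l * s m)) - (\<Sum>l\<in>UNIV. M l l)" for s
  have "\<delta> \<ge> 3" using V(2) by (simp add: \<delta>)
  have card: "real CARD('n) \<ge> 1"
    by (simp add: Suc_leI)
  have "0 \<le> ln (2 * real CARD('n))"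
    by (rule ln_ge_zero) (use card in linarith)
  then have r: "r \<ge> 0" "r' \<ge> 0"
    using \<open>\<delta> \<ge> 3\<close> by (auto simp: r_def r'_def intro!: add_nonneg_nonneg)
  have "\<tau>\<^sub>m > 0"
  proof (rule ccontr)
    assume "\<not> \<tau>\<^sub>m > 0"
    then have "sum \<tau> UNIV \<le> 0" using \<tau>_max by (intro sum_nonpos) (meson order_trans not_le)
    then show False using \<tau>(3) by simp
  qed
  have xy: "(\<Sum>i\<in>UNIV. x s i * y s i) = D s + (\<Sum>l\<in>UNIV. M l l)" for s
  proof -
    have "(\<Sum>i\<in>UNIV. x s i * y s i) = (\<Sum>i\<in>UNIV. \<Sum>l\<in>UNIV. \<Sum>m\<in>UNIV. a i l * b i m * (s l * s m))"
      by (simp add: x_def y_def sum_product mult_ac)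
    also have "\<dots> = (\<Sum>l\<in>UNIV. \<Sum>i\<in>UNIV. \<Sum>m\<in>UNIV. a i l * b i m * (s l * s m))"
      by (rule sum.swap)
    also have "\<dots> = (\<Sum>l\<in>UNIV. \<Sum>m\<in>UNIV. \<Sum>i\<in>UNIV. a i l * b i m * (s l * s m))"
      by (rule sum.cong[OF refl], rule sum.swap)
    finally show ?thesis by (simp add: D_def M_def sum_distrib_right)
  qed
  have var: "(\<Sum>l\<in>UNIV. (b i l)\<^sup>2) \<le> \<tau>\<^sub>m\<^sup>2" for i
    using \<tau>_max \<tau>(1) by (simp add: \<tau>(2) power_mono)
  define bad1 where "bad1 s \<longleftrightarrow> (\<Sum>i\<in>UNIV. \<bar>x s i\<bar>) > r * sum \<sigma> UNIV" for s
  define bad2 where "bad2 s \<longleftrightarrow> (\<Sum>i\<in>UNIV. \<bar>y s i\<bar>) > r * sum \<tau> UNIV" for s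
  define bad3 where "bad3 s \<longleftrightarrow> (\<exists>i. \<bar>y s i\<bar> > r' * \<tau>\<^sub>m)" for s
  define bad4 where "bad4 s \<longleftrightarrow> D s < - \<epsilon>" for s
  have bad1: "sign_mean (\<lambda>s. of_bool (bad1 s)) < 1 / \<delta>"
    using sign_mean_norm1_tail[OF \<sigma>(2,1,3) r(1)] tail_constants(1)[OF \<open>\<delta> \<ge> 3\<close> card]
    unfolding bad1_def x_def r_def by linarith
  have bad2: "sign_mean (\<lambda>s. of_bool (bad2 s)) < 1 / \<delta>"
    using sign_mean_norm1_tail[OF \<tau>(2,1,3) r(1)] tail_constants(1)[OF \<open>\<delta> \<ge> 3\<close> card]
    unfolding bad2_def y_def r_def by linarith
  have bad3: "sign_mean (\<lambda>s. of_bool (bad3 s)) \<le> 1 / \<delta>"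
    using sign_mean_max_tail[of b, OF var \<open>\<tau>\<^sub>m > 0\<close> r(2)] tail_constants(2)[OF \<open>\<delta> \<ge> 3\<close> card]
    unfolding bad3_def y_def r'_def by linarith
  have bad4: "sign_mean (\<lambda>s. of_bool (bad4 s)) \<le> V / (V + \<epsilon>\<^sup>2)"
    unfolding bad4_def
  proof (rule sign_mean_cantelli)
    show "sign_mean D = 0"
      unfolding D_def by (rule sign_mean_quadratic_form)
    show "sign_mean (\<lambda>s. (D s)\<^sup>2) \<le> V"
      unfolding D_def by (rule order_trans[OF sign_mean_quadratic_form(2) V(1)])
  qed (use V \<open>\<epsilon> > 0\<close> in auto)
  have "V + \<epsilon>\<^sup>2 > 0" using V(2) \<open>\<epsilon> > 0\<close> by (simp add: add_nonneg_pos)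
  have "\<delta> = 3 * (V + \<epsilon>\<^sup>2) / \<epsilon>\<^sup>2" using \<open>\<epsilon> > 0\<close> by (simp add: \<delta> field_simps)
  moreover have "3 / (3 * w / e) = e / w" for w e :: real
    by simp
  ultimately have "3 / \<delta> = \<epsilon>\<^sup>2 / (V + \<epsilon>\<^sup>2)"
    by (simp only:)
  then have "3 / \<delta> + V / (V + \<epsilon>\<^sup>2) = (\<epsilon>\<^sup>2 + V) / (V + \<epsilon>\<^sup>2)"
    by (simp only: add_divide_distrib)
  also have "\<dots> = 1" using \<open>V + \<epsilon>\<^sup>2 > 0\<close> by (simp add: add.commute)
  finally have total: "3 / \<delta> + V / (V + \<epsilon>\<^sup>2) = 1" .
  have "\<exists>s\<in>sign_vectors. \<not> (bad1 s \<or> bad2 s \<or> bad3 s \<or> bad4 s)"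
  proof (rule ccontr)
    assume "\<not> ?thesis"
    then have all_bad: "bad1 s \<or> bad2 s \<or> bad3 s \<or> bad4 s" if "s \<in> sign_vectors" for s
      using that by blast
    have "1 = sign_mean (\<lambda>s::'l \<Rightarrow> real. 1)" by (simp add: sign_mean_const)
    also have "\<dots> \<le> sign_mean (\<lambda>s. of_bool (bad1 s) + (of_bool (bad2 s) + (of_bool (bad3 s) + of_bool (bad4 s))))"
      by (rule sign_mean_mono) (use all_bad in \<open>auto simp: of_bool_def\<close>)
    also have "\<dots> < 3 / \<delta> + V / (V + \<epsilon>\<^sup>2)"
      using bad1 bad2 bad3 bad4 unfolding sign_mean_add by linarith
    finally show False using total by simp
  qed
  then obtain s where s: "s \<in> sign_vectors" "\<not> bad1 s" "\<not> bad2 s" "\<not> bad3 s" "\<not> bad4 s"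
    by blast
  show ?thesis
    by (rule that[OF s(1)])
      (use s in \<open>auto simp: bad1_def bad2_def bad3_def bad4_def r_def r'_def xy not_less\<close>)
qed

lemma inner_matrix_vector_mult: "v \<bullet> (M *v v) = (\<Sum>i\<in>UNIV. \<Sum>j\<in>UNIV. v $ i * M $ i $ j * v $ j)"
  by (simp add: inner_vec_def matrix_vector_mult_def sum_distrib_left mult.assoc)

text \<open>
  Identifies the mean and variance bound of the inner product of the rounded vectors, which is the
  quadratic form with matrix \<open>M\<close>, in terms of the solution. The mixed sum is the trace of \<open>Z Z\<close>, which
  is at most the squared Frobenius norm.
\<close>

lemma gram_moments:
  fixes a b :: "'n::finite \<Rightarrow> 'l::finite \<Rightarrow> real" and X Y Z :: "real^'n^'n"
  defines "M \<equiv> \<lambda>l m. \<Sum>i\<in>UNIV. a i l * b i m"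
  assumes X: "\<And>i j. X $ i $ j = (\<Sum>l\<in>UNIV. a i l * a j l)"
    and Y: "\<And>i j. Y $ i $ j = (\<Sum>l\<in>UNIV. b i l * b j l)"
    and Z: "\<And>i j. Z $ i $ j = (\<Sum>l\<in>UNIV. b i l * a j l)"
  shows "(\<Sum>l\<in>UNIV. M l l) = trace Z"
    and "(\<Sum>l\<in>UNIV. \<Sum>m\<in>UNIV. (M l m)\<^sup>2) = trace (X ** Y)"
    and "(\<Sum>l\<in>UNIV. \<Sum>m\<in>UNIV. M l m * M m l) \<le> (mat_norm_frob Z)\<^sup>2"
proof -
  show "(\<Sum>l\<in>UNIV. M l l) = trace Z"
    unfolding M_def trace_def Z by (subst sum.swap) (simp add: mult.commute)
  have swap: "(\<Sum>l\<in>UNIV. \<Sum>m\<in>UNIV. \<Sum>i\<in>UNIV. \<Sum>j\<in>UNIV. f i j l m)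
    = (\<Sum>i\<in>UNIV. \<Sum>j\<in>UNIV. \<Sum>l\<in>UNIV. \<Sum>m\<in>UNIV. f i j l m)"
    for f :: "'n \<Rightarrow> 'n \<Rightarrow> 'l \<Rightarrow> 'l \<Rightarrow> real"
  proof -
    have "(\<Sum>l\<in>UNIV. \<Sum>m\<in>UNIV. \<Sum>i\<in>UNIV. \<Sum>j\<in>UNIV. f i j l m)
      = (\<Sum>l\<in>UNIV. \<Sum>i\<in>UNIV. \<Sum>m\<in>UNIV. \<Sum>j\<in>UNIV. f i j l m)"
      by (rule sum.cong[OF refl], rule sum.swap)
    also have "\<dots> = (\<Sum>i\<in>UNIV. \<Sum>l\<in>UNIV. \<Sum>m\<in>UNIV. \<Sum>j\<in>UNIV. f i j l m)"
      by (rule sum.swap)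
    also have "\<dots> = (\<Sum>i\<in>UNIV. \<Sum>l\<in>UNIV. \<Sum>j\<in>UNIV. \<Sum>m\<in>UNIV. f i j l m)"
      by (rule sum.cong[OF refl], rule sum.cong[OF refl], rule sum.swap)
    also have "\<dots> = (\<Sum>i\<in>UNIV. \<Sum>j\<in>UNIV. \<Sum>l\<in>UNIV. \<Sum>m\<in>UNIV. f i j l m)"
      by (rule sum.cong[OF refl], rule sum.swap)
    finally show ?thesis .
  qed
  have "(\<Sum>l\<in>UNIV. \<Sum>m\<in>UNIV. (M l m)\<^sup>2)
    = (\<Sum>l\<in>UNIV. \<Sum>m\<in>UNIV. \<Sum>i\<in>UNIV. \<Sum>j\<in>UNIV. (a i l * a j l) * (b i m * b j m))"
    by (simp add: M_def power2_eq_square sum_product mult_ac)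
  also have "\<dots> = (\<Sum>i\<in>UNIV. \<Sum>j\<in>UNIV. X $ i $ j * Y $ i $ j)"
    unfolding swap X Y sum_product ..
  also have "\<dots> = trace (X ** Y)"
    by (simp add: trace_def matrix_matrix_mult_def X Y mult.commute)
  finally show "(\<Sum>l\<in>UNIV. \<Sum>m\<in>UNIV. (M l m)\<^sup>2) = trace (X ** Y)" .
  have "(\<Sum>l\<in>UNIV. \<Sum>m\<in>UNIV. M l m * M m l)
    = (\<Sum>l\<in>UNIV. \<Sum>m\<in>UNIV. \<Sum>i\<in>UNIV. \<Sum>j\<in>UNIV. (b j l * a i l) * (b i m * a j m))"
    by (simp add: M_def sum_product mult_ac)
  also have "\<dots> = (\<Sum>i\<in>UNIV. \<Sum>j\<in>UNIV. Z $ j $ i * Z $ i $ j)"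
    unfolding swap Z sum_product ..
  also have "\<dots> \<le> (\<Sum>i\<in>UNIV. \<Sum>j\<in>UNIV. ((Z $ j $ i)\<^sup>2 + (Z $ i $ j)\<^sup>2) / 2)"
  proof (intro sum_mono)
    fix i j
    show "Z $ j $ i * Z $ i $ j \<le> ((Z $ j $ i)\<^sup>2 + (Z $ i $ j)\<^sup>2) / 2"
      using sum_squares_bound[of "Z $ j $ i" "Z $ i $ j"] by simp
  qed
  also have "\<dots> = (mat_norm_frob Z)\<^sup>2"
  proof -
    have "(\<Sum>i\<in>UNIV. \<Sum>j\<in>UNIV. (Z $ j $ i)\<^sup>2) = (\<Sum>i\<in>UNIV. \<Sum>j\<in>UNIV. (Z $ i $ j)\<^sup>2)"
      by (rule sum.swap)
    then show ?thesis
      by (simp add: mat_norm_frob_def sum_nonneg add_divide_distrib sum.distrib sum_divide_distrib[symmetric])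
  qed
  finally show "(\<Sum>l\<in>UNIV. \<Sum>m\<in>UNIV. M l m * M m l) \<le> (mat_norm_frob Z)\<^sup>2" .
qed

text \<open>
  A factorization of the block matrix gives vectors for the rows of both blocks over one common index
  type, so the same random signs round \<open>X\<close> and \<open>Y\<close> jointly and reproduce the correlation \<open>Z\<close>.
\<close>

lemma sdp_feasible_gram:
  fixes A :: "real^'n^'m" and X Y Z :: "real^'n^'n"
  assumes "sdp_feasible A k X Y Z"
  obtains a b :: "'n \<Rightarrow> 'n + 'n \<Rightarrow> real"
  where "\<And>i j. X $ i $ j = (\<Sum>l\<in>UNIV. a i l * a j l)"
    and "\<And>i j. Y $ i $ j = (\<Sum>l\<in>UNIV. b i l * b j l)"
    and "\<And>i j. Z $ i $ j = (\<Sum>l\<in>UNIV. b i l * a j l)"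
    and "\<And>l. A *v (\<chi> i. a i l) = 0"
proof -
  define W where "W = block_mat X (transpose Z) Z Y"
  have psd: "pos_semidef W" and AXA: "A ** X ** transpose A = 0"
    using assms by (auto simp: sdp_feasible_def W_def)
  have "\<exists>u. \<forall>i\<in>UNIV. \<forall>j\<in>UNIV. W $ i $ j = (\<Sum>l\<in>(UNIV :: ('n + 'n) set). u l i * u l j)"
  proof (rule psd_gram_factorization[of UNIV "\<lambda>i j. W $ i $ j"])
    have "transpose W $ i $ j = W $ i $ j" for i j
      using psd by (simp add: pos_semidef_def symmetric_mat_def)
    then show "W $ i $ j = W $ j $ i" for i j
      by (simp add: transpose_def)
    show "0 \<le> (\<Sum>i\<in>UNIV. \<Sum>j\<in>UNIV. v i * W $ i $ j * v j)" for v
    proof -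
      have "0 \<le> (\<chi> i. v i) \<bullet> (W *v (\<chi> i. v i))"
        using psd unfolding pos_semidef_def by blast
      then show ?thesis by (simp add: inner_matrix_vector_mult)
    qed
  qed simp
  then obtain u where u: "\<And>i j. W $ i $ j = (\<Sum>l\<in>(UNIV :: ('n + 'n) set). u l i * u l j)" by auto
  have X: "X $ i $ j = (\<Sum>l\<in>UNIV. u l (Inl i) * u l (Inl j))" for i j
    using u[of "Inl i" "Inl j"] by (simp add: W_def block_mat_def)
  have Y: "Y $ i $ j = (\<Sum>l\<in>UNIV. u l (Inr i) * u l (Inr j))" for i j
    using u[of "Inr i" "Inr j"] by (simp add: W_def block_mat_def)
  have Z: "Z $ i $ j = (\<Sum>l\<in>UNIV. u l (Inr i) * u l (Inl j))" for i j
    using u[of "Inr i" "Inl j"] by (simp add: W_def block_mat_def)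
  show ?thesis
    by (rule that[of "\<lambda>i l. u l (Inl i)" "\<lambda>i l. u l (Inr i)"])
      (use X Y Z kernel_of_gram_columns[OF AXA X] in auto)
qed

theorem theorem4:
  fixes A :: "real^'n^'m"
    and X Y Z :: "real^'n^'n"
    and \<epsilon> \<delta> :: real
    and k :: nat
  assumes "CARD('n) > CARD('m)"
    and "\<epsilon> > 0"
    and "k \<ge> 1"
    and "sdp_optimal A k X Y Z"
    and "\<delta> = delta_val X Y Z \<epsilon>"
  shows "(sdp_value A k - \<epsilon>) / (g_fun X \<delta> * h_fun Y k \<delta>) \<le> alpha A k
    \<and> alpha A k \<le> sdp_value A k"
proof
  show "alpha A k \<le> sdp_value A k"
    using assms by (intro alpha_le_sdp_value) auto
  have "sdp_feasible A k X Y Z"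
    using assms(4) by (simp add: sdp_optimal_def)
  then obtain a b :: "'n \<Rightarrow> 'n + 'n \<Rightarrow> real"
    where X: "\<And>i j. X $ i $ j = (\<Sum>l\<in>UNIV. a i l * a j l)"
      and Y: "\<And>i j. Y $ i $ j = (\<Sum>l\<in>UNIV. b i l * b j l)"
      and Z: "\<And>i j. Z $ i $ j = (\<Sum>l\<in>UNIV. b i l * a j l)"
      and Aa: "\<And>l. A *v (\<chi> i. a i l) = 0"
    by (rule sdp_feasible_gram) blast
  define \<sigma> where "\<sigma> i = sqrt (X $ i $ i)" for i
  define \<tau> where "\<tau> i = sqrt (Y $ i $ i)" for i
  define \<tau>\<^sub>m where "\<tau>\<^sub>m = Max {\<tau> i | i. True}"
  define V where "V = (mat_norm_frob Z)\<^sup>2 + trace (X ** Y)"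
  note moments = gram_moments[OF X Y Z]
  have diag: "0 \<le> X $ i $ i" "0 \<le> Y $ i $ i" for i
    unfolding X Y by (auto intro!: sum_nonneg)
  have \<sigma>: "0 \<le> \<sigma> i" "(\<Sum>l\<in>UNIV. (a i l)\<^sup>2) = (\<sigma> i)\<^sup>2" for i
    using diag by (simp_all add: \<sigma>_def) (simp add: X power2_eq_square)
  have \<tau>: "0 \<le> \<tau> i" "(\<Sum>l\<in>UNIV. (b i l)\<^sup>2) = (\<tau> i)\<^sup>2" for i
    using diag by (simp_all add: \<tau>_def) (simp add: Y power2_eq_square)
  have "{\<tau> i | i. True} = range \<tau>" by auto
  then have \<tau>_max: "\<tau> i \<le> \<tau>\<^sub>m" for i
    unfolding \<tau>\<^sub>m_def by simp
  have "0 \<le> trace (X ** Y)"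
    unfolding moments(2)[symmetric] by (intro sum_nonneg) auto
  then have "V \<ge> 0" by (simp add: V_def)
  have \<delta>: "\<delta> = 3 + 3 * V / \<epsilon>\<^sup>2" by (simp add: assms(5) delta_val_def V_def)
  then have "\<delta> \<ge> 3" using \<open>V \<ge> 0\<close> by simp
  define r where "r = sqrt (2 / pi) + sqrt (2 * ln \<delta>)"
  define r' where "r' = sqrt (2 * ln (2 * real CARD('n))) + sqrt (2 * ln \<delta>)"
  have g: "g_fun X \<delta> = r * sum \<sigma> UNIV" by (simp add: g_fun_def r_def \<sigma>_def)
  have h: "h_fun Y k \<delta> = max (r' * \<tau>\<^sub>m) (r * sum \<tau> UNIV / real k)"
    by (simp add: h_fun_def r_def r'_def \<tau>_def \<tau>\<^sub>m_def)
  have r: "r > 0" using \<open>\<delta> \<ge> 3\<close> by (auto simp: r_def intro!: add_pos_nonneg)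
  have alpha: "0 \<le> alpha A k" using assms by (intro alpha_nonneg) auto
  show "(sdp_value A k - \<epsilon>) / (g_fun X \<delta> * h_fun Y k \<delta>) \<le> alpha A k"
  proof (cases "trace Z > \<epsilon> \<and> sum \<sigma> UNIV > 0 \<and> sum \<tau> UNIV > 0")
    case True
    have "(\<Sum>l\<in>UNIV. \<Sum>m\<in>UNIV. (\<Sum>i\<in>UNIV. a i l * b i m)\<^sup>2
        + (\<Sum>i\<in>UNIV. a i l * b i m) * (\<Sum>i\<in>UNIV. a i m * b i l)) \<le> V"
      using moments(2,3) by (simp add: V_def sum.distrib)
    with True obtain s where s: "s \<in> sign_vectors"
      "(\<Sum>i\<in>UNIV. \<bar>\<Sum>l\<in>UNIV. a i l * s l\<bar>) \<le> r * sum \<sigma> UNIV"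
      "(\<Sum>i\<in>UNIV. \<bar>\<Sum>l\<in>UNIV. b i l * s l\<bar>) \<le> r * sum \<tau> UNIV"
      "\<And>i. \<bar>\<Sum>l\<in>UNIV. b i l * s l\<bar> \<le> r' * \<tau>\<^sub>m"
      "(\<Sum>l\<in>UNIV. \<Sum>i\<in>UNIV. a i l * b i l) - \<epsilon>
        \<le> (\<Sum>i\<in>UNIV. (\<Sum>l\<in>UNIV. a i l * s l) * (\<Sum>l\<in>UNIV. b i l * s l))"
      using exists_good_signs[of \<sigma> a \<tau> b \<tau>\<^sub>m V \<epsilon> \<delta>] \<sigma> \<tau> \<tau>_max \<open>V \<ge> 0\<close> \<open>\<epsilon> > 0\<close> \<delta>
      unfolding r_def r'_def by blast
    define x :: "real^'n" where "x = (\<chi> i. \<Sum>l\<in>UNIV. a i l * s l)"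
    define y :: "real^'n" where "y = (\<chi> i. \<Sum>l\<in>UNIV. b i l * s l)"
    have yx: "trace Z - \<epsilon> \<le> y \<bullet> x"
      using s(5) by (simp add: moments(1) x_def y_def inner_vec_def mult.commute)
    have "A *v x = (\<Sum>l\<in>UNIV. s l *\<^sub>R (A *v (\<chi> i. a i l)))"
    proof -
      have "x = (\<Sum>l\<in>UNIV. s l *\<^sub>R (\<chi> i. a i l))"
        by (simp add: x_def vec_eq_iff mult.commute)
      then show ?thesis
        by (simp only: matrix_vector_mult_scaleR linear_sum[OF matrix_vector_mul_linear])
    qed
    then have Ax: "A *v x = 0" by (simp add: Aa)
    have "r * sum \<tau> UNIV / real k > 0" using True r \<open>k \<ge> 1\<close> by simp
    then have h_pos: "h_fun Y k \<delta> > 0" by (simp add: h less_max_iff_disj)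
    have g_pos: "g_fun X \<delta> > 0" using True r by (simp add: g)
    have "infnorm y \<le> h_fun Y k \<delta>"
      using s(4) by (simp add: infnorm_le_iff_cart h y_def le_max_iff_disj)
    moreover have "vec_norm1 y \<le> real k * h_fun Y k \<delta>"
    proof -
      have "vec_norm1 y \<le> r * sum \<tau> UNIV"
        using s(3) by (simp add: vec_norm1_def y_def)
      also have "\<dots> = real k * (r * sum \<tau> UNIV / real k)" using \<open>k \<ge> 1\<close> by simp
      also have "\<dots> \<le> real k * h_fun Y k \<delta>"
        unfolding h by (intro mult_left_mono) auto
      finally show ?thesis .
    qed
    moreover have "vec_norm1 x \<le> g_fun X \<delta>"
      using s(2) by (simp add: vec_norm1_def x_def g)
    moreover have "x \<noteq> 0" using yx True by auto
    ultimately have "(y \<bullet> x) / (g_fun X \<delta> * h_fun Y k \<delta>) \<le> alpha A k"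
      using Ax h_pos \<open>k \<ge> 1\<close> yx True by (intro scaled_inner_le_alpha) auto
    moreover have "(sdp_value A k - \<epsilon>) / (g_fun X \<delta> * h_fun Y k \<delta>)
        \<le> (y \<bullet> x) / (g_fun X \<delta> * h_fun Y k \<delta>)"
      using yx g_pos h_pos
      by (intro divide_right_mono) (auto simp: sdp_value_eq_trace[OF assms(4)])
    ultimately show ?thesis by linarith
  next
    case False
    have "0 \<le> sum \<sigma> UNIV" "0 \<le> sum \<tau> UNIV" using \<sigma> \<tau> by (auto intro: sum_nonneg)
    then have g0: "0 \<le> g_fun X \<delta>" and "0 \<le> r * sum \<tau> UNIV / real k"
      using r by (auto simp: g)
    then have h0: "0 \<le> h_fun Y k \<delta>" by (simp add: h le_max_iff_disj)
    \<comment> \<open>The bound is trivial: a nonpositive numerator, or a zero denominator and hence a zero quotient.\<close>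
    from False consider "trace Z \<le> \<epsilon>" | "sum \<sigma> UNIV = 0" | "sum \<tau> UNIV = 0"
      using \<open>0 \<le> sum \<sigma> UNIV\<close> \<open>0 \<le> sum \<tau> UNIV\<close> by linarith
    then have "(sdp_value A k - \<epsilon>) / (g_fun X \<delta> * h_fun Y k \<delta>) \<le> 0"
    proof cases
      case 1
      then show ?thesis using g0 h0
        by (intro divide_nonpos_nonneg) (auto simp: sdp_value_eq_trace[OF assms(4)])
    next
      case 2
      then show ?thesis by (simp add: g)
    next
      case 3
      then have "\<tau> i = 0" for i using \<tau>(1) by (simp add: sum_nonneg_eq_0_iff)
      then have "h_fun Y k \<delta> = 0" using 3 by (simp add: h \<tau>\<^sub>m_def)
      then show ?thesis by simp
    qed
    then show ?thesis using alpha by linarith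
  qed
qed

end
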